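(* Let $X$ and $Y$ be compact connected complex manifolds. Then $$h^{0,1}_{BC}(X\times Y)= h^{0,1}_{BC}(X)+h^{0,1}_{BC}(Y)$$ and $$h^{0,1}_{A}(X\times Y)\geq h^{0,1}_{A}(X)+h^{0,1}_{A}(Y).$$
   Context: For a compact complex manifold $M$ let $\mathcal{A}^{p,q}(M)$ be the space of smooth complex-valued $(p,q)$-forms on $M$ (zero if $p<0$ or $q<0$). The Bott-Chern and Aeppli cohomology groups are $$H^{p,q}_{BC}(M)=\frac{\{\alpha\in\mathcal{A}^{p,q}(M) : d\alpha=0\}}{\{i\partial\bar\partial\beta : \beta\in\mathcal{A}^{p-1,q-1}(M)\}},\qquad H^{p,q}_{A}(M)=\frac{\{\alpha\in\mathcal{A}^{p,q}(M) : i\partial\bar\partial\alpha=0\}}{\{\partial\beta+\bar\partial\gamma : \beta\in\mathcal{A}^{p-1,q}(M),\ \gamma\in\mathcal{A}^{p,q-1}(M)\}},$$ and $h^{p,q}_{BC}(M)$, $h^{p,q}_A(M)$ denote their (finite) complex dimensions. *)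

theory Defs
  imports "HOL-Analysis.Analysis" "HOL-Library.Function_Algebras"
begin

section \<open>Functions of several complex variables\<close>

text \<open>
  Complex n-space consists of the sequences that vanish from index n on, so that the dimension is
  a natural number which may be 0 and dimensions can be added. The product topology on sequences
  induces the usual topology on it.
\<close>

definition cspace :: "nat \<Rightarrow> (nat \<Rightarrow> complex) set" where
  "cspace n = {z. \<forall>i\<ge>n. z i = 0}"

text \<open>
  Real partial derivative in the j-th complex coordinate: with respect to the real part
  for c = 1, and with respect to the imaginary part for c = \<open>\<i>\<close>.
\<close>

definition line_in :: "complex \<Rightarrow> nat \<Rightarrow> ((nat \<Rightarrow> complex) \<Rightarrow> complex) \<Rightarrow> (nat \<Rightarrow> complex) \<Rightarrow> real \<Rightarrow> complex" where
  "line_in c j f z = (\<lambda>t. f (z(j := z j + complex_of_real t * c)))"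

definition pd :: "complex \<Rightarrow> nat \<Rightarrow> ((nat \<Rightarrow> complex) \<Rightarrow> complex) \<Rightarrow> (nat \<Rightarrow> complex) \<Rightarrow> complex" where
  "pd c j f z = vector_derivative (line_in c j f z) (at 0)"

primrec Ck_on :: "nat \<Rightarrow> nat \<Rightarrow> (nat \<Rightarrow> complex) set \<Rightarrow> ((nat \<Rightarrow> complex) \<Rightarrow> complex) \<Rightarrow> bool" where
  "Ck_on n 0 V f \<longleftrightarrow> continuous_on V f"
| "Ck_on n (Suc k) V f \<longleftrightarrow> continuous_on V f \<and>
     (\<forall>j<n. \<forall>c\<in>{1, \<i>}. (\<forall>z\<in>V. line_in c j f z differentiable (at 0)) \<and> Ck_on n k V (pd c j f))"

definition smooth_on :: "nat \<Rightarrow> (nat \<Rightarrow> complex) set \<Rightarrow> ((nat \<Rightarrow> complex) \<Rightarrow> complex) \<Rightarrow> bool" where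
  "smooth_on n V f \<longleftrightarrow> (\<forall>k. Ck_on n k V f)"

text \<open>The Wirtinger derivatives with respect to the j-th coordinate and its conjugate.\<close>

definition dz :: "nat \<Rightarrow> ((nat \<Rightarrow> complex) \<Rightarrow> complex) \<Rightarrow> (nat \<Rightarrow> complex) \<Rightarrow> complex" where
  "dz j f z = (pd 1 j f z - \<i> * pd \<i> j f z) / 2"

definition dzbar :: "nat \<Rightarrow> ((nat \<Rightarrow> complex) \<Rightarrow> complex) \<Rightarrow> (nat \<Rightarrow> complex) \<Rightarrow> complex" where
  "dzbar j f z = (pd 1 j f z + \<i> * pd \<i> j f z) / 2"

text \<open>Holomorphy in several variables: continuous and holomorphic in each variable separately.\<close>

definition holo_on :: "nat \<Rightarrow> (nat \<Rightarrow> complex) set \<Rightarrow> ((nat \<Rightarrow> complex) \<Rightarrow> complex) \<Rightarrow> bool" where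
  "holo_on n V f \<longleftrightarrow> continuous_on V f \<and>
     (\<forall>j<n. \<forall>z\<in>V. (\<lambda>t. f (z(j := t))) field_differentiable (at (z j)))"

section \<open>Complex manifolds\<close>

text \<open>
  A chart is a pair of an open set and a coordinate map; the values of the map outside
  the open set are irrelevant.
\<close>

type_synonym 'a chart = "'a set \<times> ('a \<Rightarrow> nat \<Rightarrow> complex)"

record 'a manifold =
  mtop :: "'a topology"
  mdim :: nat
  atlas :: "'a chart set"

definition chart_image :: "'a chart \<Rightarrow> (nat \<Rightarrow> complex) set" where
  "chart_image c = snd c ` fst c"

definition is_chart :: "'a topology \<Rightarrow> nat \<Rightarrow> 'a chart \<Rightarrow> bool" where
  "is_chart T n c \<longleftrightarrow> openin T (fst c) \<and> openin (top_of_set (cspace n)) (chart_image c) \<and>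
     homeomorphic_map (subtopology T (fst c)) (top_of_set (chart_image c)) (snd c)"

definition overlap :: "'a chart \<Rightarrow> 'a chart \<Rightarrow> (nat \<Rightarrow> complex) set" where
  "overlap c c' = snd c ` (fst c \<inter> fst c')"

text \<open>The change of coordinates from \<open>c\<close> to \<open>c'\<close>, meaningful on \<open>overlap c c'\<close>.\<close>

definition chart_change :: "'a chart \<Rightarrow> 'a chart \<Rightarrow> (nat \<Rightarrow> complex) \<Rightarrow> (nat \<Rightarrow> complex)" where
  "chart_change c c' z = snd c' (inv_into (fst c) (snd c) z)"

definition complex_manifold :: "'a manifold \<Rightarrow> bool" where
  "complex_manifold M \<longleftrightarrow>
     Hausdorff_space (mtop M) \<and>
     (\<exists>\<B>. countable \<B> \<and> (\<forall>B\<in>\<B>. openin (mtop M) B) \<and>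
        (\<forall>U x. openin (mtop M) U \<and> x \<in> U \<longrightarrow> (\<exists>B\<in>\<B>. x \<in> B \<and> B \<subseteq> U))) \<and>
     (\<forall>c\<in>atlas M. is_chart (mtop M) (mdim M) c) \<and>
     (\<Union>c\<in>atlas M. fst c) = topspace (mtop M) \<and>
     (\<forall>c\<in>atlas M. \<forall>c'\<in>atlas M. \<forall>k<mdim M. holo_on (mdim M) (overlap c c') (\<lambda>z. chart_change c c' z k))"

text \<open>
  The library counts the empty space as connected, hence the explicit nonemptiness.
\<close>

definition compact_connected_complex_manifold :: "'a manifold \<Rightarrow> bool" where
  "compact_connected_complex_manifold M \<longleftrightarrow>
     complex_manifold M \<and> compact_space (mtop M) \<and> connected_space (mtop M) \<and> topspace (mtop M) \<noteq> {}"

text \<open>The coordinates of the second factor are placed after the n coordinates of the first one.\<close>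

definition prod_chart :: "nat \<Rightarrow> 'a chart \<Rightarrow> 'b chart \<Rightarrow> ('a \<times> 'b) chart" where
  "prod_chart n c c' =
     (fst c \<times> fst c', \<lambda>(x, y) i. if i < n then snd c x i else snd c' y (i - n))"

definition prod_manifold :: "'a manifold \<Rightarrow> 'b manifold \<Rightarrow> ('a \<times> 'b) manifold" where
  "prod_manifold M N =
     \<lparr>mtop = prod_topology (mtop M) (mtop N),
      mdim = mdim M + mdim N,
      atlas = {prod_chart (mdim M) c c' | c c'. c \<in> atlas M \<and> c' \<in> atlas N}\<rparr>"

section \<open>Differential forms\<close>

text \<open>
  A form is given by its components in the charts of the atlas, with \<open>\<omega> c z ps qs\<close> being the
  component at the coordinate point \<open>z\<close> of the chart \<open>c\<close> for the holomorphic indices \<open>ps\<close> and the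
  antiholomorphic indices \<open>qs\<close>. In the chart \<open>c\<close> the (p,q)-part of the form is
  1/(p! q!) times the sum over all index lists of lengths p and q of
  \<open>\<omega> c z ps qs\<close> times the wedge product of the \<open>dz\<close> for \<open>ps\<close> followed by the conjugate \<open>dz\<close> for \<open>qs\<close>,
  where the components are alternating in \<open>ps\<close> and in \<open>qs\<close>.
  Components are 0 outside of the meaningful arguments, so that equal forms are equal functions.
\<close>

type_synonym 'a form = "'a chart \<Rightarrow> (nat \<Rightarrow> complex) \<Rightarrow> nat list \<Rightarrow> nat list \<Rightarrow> complex"

definition meaningful :: "'a manifold \<Rightarrow> 'a chart \<Rightarrow> (nat \<Rightarrow> complex) \<Rightarrow> nat list \<Rightarrow> nat list \<Rightarrow> bool" where
  "meaningful M c z ps qs \<longleftrightarrow>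
     c \<in> atlas M \<and> z \<in> chart_image c \<and> set ps \<subseteq> {..<mdim M} \<and> set qs \<subseteq> {..<mdim M}"

definition swap_at :: "nat \<Rightarrow> nat \<Rightarrow> nat list \<Rightarrow> nat list" where
  "swap_at a b xs = xs[a := xs ! b, b := xs ! a]"

definition alternating :: "'a form \<Rightarrow> bool" where
  "alternating \<omega> \<longleftrightarrow> (\<forall>c z ps qs.
     (\<forall>a b. a < b \<and> b < length ps \<longrightarrow> \<omega> c z (swap_at a b ps) qs = - \<omega> c z ps qs) \<and>
     (\<forall>a b. a < b \<and> b < length qs \<longrightarrow> \<omega> c z ps (swap_at a b qs) = - \<omega> c z ps qs))"

definition indices :: "nat \<Rightarrow> nat \<Rightarrow> nat list set" where
  "indices n l = {xs. length xs = l \<and> set xs \<subseteq> {..<n}}"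

text \<open>The transformation law of the components under changes of coordinates.\<close>

definition compatible :: "'a manifold \<Rightarrow> 'a form \<Rightarrow> bool" where
  "compatible M \<omega> \<longleftrightarrow> (\<forall>c\<in>atlas M. \<forall>c'\<in>atlas M. \<forall>z\<in>overlap c c'.
     \<forall>ps qs. set ps \<subseteq> {..<mdim M} \<longrightarrow> set qs \<subseteq> {..<mdim M} \<longrightarrow>
       \<omega> c z ps qs =
         (\<Sum>ks\<in>indices (mdim M) (length ps). \<Sum>ls\<in>indices (mdim M) (length qs).
            (\<Prod>a<length ps. dz (ps ! a) (\<lambda>w. chart_change c c' w (ks ! a)) z) *
            (\<Prod>b<length qs. cnj (dz (qs ! b) (\<lambda>w. chart_change c c' w (ls ! b)) z)) *
            \<omega> c' (chart_change c c' z) ks ls))"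

text \<open>For negative p or q only the zero form satisfies this.\<close>

definition forms :: "'a manifold \<Rightarrow> int \<Rightarrow> int \<Rightarrow> 'a form set" where
  "forms M p q = {\<omega>.
     (\<forall>c z ps qs. \<not> (meaningful M c z ps qs \<and> int (length ps) = p \<and> int (length qs) = q) \<longrightarrow>
        \<omega> c z ps qs = 0) \<and>
     (\<forall>c\<in>atlas M. \<forall>ps qs. smooth_on (mdim M) (chart_image c) (\<lambda>z. \<omega> c z ps qs)) \<and>
     alternating \<omega> \<and> compatible M \<omega>}"

definition omit :: "nat \<Rightarrow> nat list \<Rightarrow> nat list" where
  "omit a xs = take a xs @ drop (Suc a) xs"

definition del :: "'a manifold \<Rightarrow> 'a form \<Rightarrow> 'a form" where
  "del M \<omega> c z ps qs = (if meaningful M c z ps qs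
     then \<Sum>a<length ps. (- 1) ^ a * dz (ps ! a) (\<lambda>w. \<omega> c w (omit a ps) qs) z else 0)"

text \<open>
  The sign in front of the sum comes from moving the new conjugate differential past
  the holomorphic ones.
\<close>

definition delbar :: "'a manifold \<Rightarrow> 'a form \<Rightarrow> 'a form" where
  "delbar M \<omega> c z ps qs = (if meaningful M c z ps qs
     then (- 1) ^ length ps *
       (\<Sum>b<length qs. (- 1) ^ b * dzbar (qs ! b) (\<lambda>w. \<omega> c w ps (omit b qs)) z) else 0)"

text \<open>
  The two summands have different bidegrees and hence are supported on index lists of
  different lengths.
\<close>

definition ext_d :: "'a manifold \<Rightarrow> 'a form \<Rightarrow> 'a form" where
  "ext_d M \<omega> = del M \<omega> + delbar M \<omega>"

definition cscale :: "complex \<Rightarrow> 'a form \<Rightarrow> 'a form" where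
  "cscale a \<omega> = (\<lambda>c z ps qs. a * \<omega> c z ps qs)"

section \<open>Bott-Chern and Aeppli cohomology\<close>

text \<open>
  Complex dimension of the quotient of \<open>V\<close> by \<open>W\<close>: the supremum of the sizes of the finite
  sets of elements of \<open>V\<close> whose classes are distinct and linearly independent in the quotient.
\<close>

definition quotient_dim :: "'a form set \<Rightarrow> 'a form set \<Rightarrow> enat" where
  "quotient_dim V W = (SUP S \<in> {S. finite S \<and> S \<subseteq> V \<and>
     (\<forall>u. (\<Sum>s\<in>S. cscale (u s) s) \<in> W \<longrightarrow> (\<forall>s\<in>S. u s = 0))}. enat (card S))"

definition BC_cocycles :: "'a manifold \<Rightarrow> int \<Rightarrow> int \<Rightarrow> 'a form set" where
  "BC_cocycles M p q = {\<alpha> \<in> forms M p q. ext_d M \<alpha> = 0}"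

definition BC_coboundaries :: "'a manifold \<Rightarrow> int \<Rightarrow> int \<Rightarrow> 'a form set" where
  "BC_coboundaries M p q = {cscale \<i> (del M (delbar M \<beta>)) | \<beta>. \<beta> \<in> forms M (p - 1) (q - 1)}"

definition h_BC :: "int \<Rightarrow> int \<Rightarrow> 'a manifold \<Rightarrow> enat" where
  "h_BC p q M = quotient_dim (BC_cocycles M p q) (BC_coboundaries M p q)"

definition A_cocycles :: "'a manifold \<Rightarrow> int \<Rightarrow> int \<Rightarrow> 'a form set" where
  "A_cocycles M p q = {\<alpha> \<in> forms M p q. cscale \<i> (del M (delbar M \<alpha>)) = 0}"

definition A_coboundaries :: "'a manifold \<Rightarrow> int \<Rightarrow> int \<Rightarrow> 'a form set" where
  "A_coboundaries M p q =
     {del M \<beta> + delbar M \<gamma> | \<beta> \<gamma>. \<beta> \<in> forms M (p - 1) q \<and> \<gamma> \<in> forms M p (q - 1)}"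

definition h_A :: "int \<Rightarrow> int \<Rightarrow> 'a manifold \<Rightarrow> enat" where
  "h_A p q M = quotient_dim (A_cocycles M p q) (A_coboundaries M p q)"

end

theory Submission
  imports Defs "HOL-Complex_Analysis.Conformal_Mappings"
begin

text \<open>
  Pulling forms back along the two projections and restricting them to the slices
  \<open>X \<times> {y}\<close> and \<open>{x} \<times> Y\<close> commutes with \<open>\<partial>\<close> and its conjugate. Restricting a pullback gives the
  original form back on the slice along its own factor, and 0 on the other slice. Hence the sum of the
  two pullbacks is injective on cohomology, which gives both lower bounds.

  There are no nonzero coboundaries in the Bott-Chern cohomology of bidegree (0,1), and the
  cocycles have antiholomorphic coefficients. For a cocycle on the product, a coefficient in a
  direction along \<open>X\<close> is for a fixed point of \<open>X\<close> a global antiholomorphic function on \<open>Y\<close>, hence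
  constant by the maximum principle, and vice versa. So the cocycle is the sum of the pullbacks of its
  restrictions to the slices.
\<close>

section \<open>Substitution and locality for partial derivatives\<close>

text \<open>Smoothness is defined through partial derivatives along real lines. Complex analysis
  becomes available only after continuous partial derivatives have been assembled into a real
  derivative; the Cauchy-Riemann equation then makes the conjugate of a coefficient holomorphic in
  each variable. A second obstacle comes from the values of coordinate maps outside their domains: a
  chart of the product does not determine its factors. A pullback therefore has to choose them, and
  the transformation law shows that the choice does not matter. In the Aeppli case the cocycle
  condition constrains only second derivatives of the coefficients. They need not be
  antiholomorphic, so the maximum principle yields no splitting and the argument stops at the lower
  bound. Dimensions are suprema in \<open>enat\<close>, so each estimate also has to cover infinite
  values.\<close>

lemma continuous_on_coordinate_update:
  assumes "continuous_on S v"
  shows "continuous_on S (\<lambda>t. (z(j := v t)) :: nat \<Rightarrow> complex)"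
proof (rule continuous_on_coordinatewise_then_product)
  show "continuous_on S (\<lambda>t. (z(j := v t)) i)" for i
    using assms by (cases "i = j") auto
qed

text \<open>The set \<open>V\<close> is open only relative to \<open>cspace n\<close>. The condition
  \<open>j < n\<close> keeps the line inside that space.\<close>

lemma eventually_line_in_open:
  assumes V: "openin (top_of_set (cspace n)) V" and z: "z \<in> V" and j: "j < n"
  shows "\<forall>\<^sub>F t::real in nhds 0. z(j := z j + complex_of_real t * c) \<in> V"
proof -
  obtain U where U: "open U" "V = cspace n \<inter> U"
    using V by (auto simp: openin_open)
  have "open ((\<lambda>t::real. z(j := z j + complex_of_real t * c)) -` U)"
    by (intro open_vimage[OF U(1)] continuous_on_coordinate_update continuous_intros)
  moreover have "0 \<in> (\<lambda>t::real. z(j := z j + complex_of_real t * c)) -` U"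
    using z U by simp
  ultimately have "\<forall>\<^sub>F t::real in nhds 0. t \<in> (\<lambda>t. z(j := z j + complex_of_real t * c)) -` U"
    by (rule eventually_nhds_in_open)
  then show ?thesis
    by eventually_elim (use z U j in \<open>auto simp: cspace_def\<close>)
qed

lemma eventually_line_in_cong:
  assumes "openin (top_of_set (cspace n)) V" "z \<in> V" "j < n" "\<And>w. w \<in> V \<Longrightarrow> f w = g w"
  shows "\<forall>\<^sub>F t in nhds 0. line_in c j f z t = line_in c j g z t"
  using eventually_line_in_open[OF assms(1-3), of c]
  by eventually_elim (simp add: line_in_def assms(4))

text \<open>The derivative depends only on the values near \<open>z\<close> along the line. This
  matters because components of forms are set to 0 outside the chart image, so formulas for them
  hold only on that open set.\<close>

lemma pd_cong:
  assumes "openin (top_of_set (cspace n)) V" "z \<in> V" "j < n" "\<And>w. w \<in> V \<Longrightarrow> f w = g w"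
  shows "pd c j f z = pd c j g z"
  unfolding pd_def
  by (rule vector_derivative_cong_eq) (use eventually_line_in_cong[OF assms] in auto)

lemma differentiable_line_in_cong:
  assumes "openin (top_of_set (cspace n)) V" "z \<in> V" "j < n" "\<And>w. w \<in> V \<Longrightarrow> f w = g w"
    and "line_in c j f z differentiable (at 0)"
  shows "line_in c j g z differentiable (at 0)"
proof -
  have "\<forall>\<^sub>F t in nhds 0. line_in c j f z t = line_in c j g z t"
    by (rule eventually_line_in_cong[OF assms(1-4)])
  then obtain d where "d > 0" "\<And>t. dist t 0 < d \<Longrightarrow> line_in c j f z t = line_in c j g z t"
    unfolding eventually_nhds_metric by blast
  then show ?thesis
    using differentiable_transform_within[OF assms(5), of d] by simp
qed

lemma dz_cong:
  assumes "openin (top_of_set (cspace n)) V" "z \<in> V" "j < n" "\<And>w. w \<in> V \<Longrightarrow> f w = g w"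
  shows "dz j f z = dz j g z"
  by (simp add: dz_def pd_cong[OF assms])

lemma dzbar_cong:
  assumes "openin (top_of_set (cspace n)) V" "z \<in> V" "j < n" "\<And>w. w \<in> V \<Longrightarrow> f w = g w"
  shows "dzbar j f z = dzbar j g z"
  by (simp add: dzbar_def pd_cong[OF assms])

text \<open>By locality the first derivatives agree on \<open>V\<close> as well, which is what the
  induction on the order requires of the next pair of functions.\<close>

lemma Ck_on_cong:
  assumes "openin (top_of_set (cspace n)) V" "\<And>w. w \<in> V \<Longrightarrow> f w = g w" "Ck_on n r V f"
  shows "Ck_on n r V g"
  using assms(2,3)
proof (induction r arbitrary: f g)
  case 0
  then show ?case
    by (metis Ck_on.simps(1) continuous_on_cong)
next
  case (Suc r)
  have "Ck_on n r V (pd c j g)" if "j < n" "c \<in> {1, \<i>}" for c j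
  proof (rule Suc.IH)
    show "pd c j f w = pd c j g w" if "w \<in> V" for w
      using pd_cong[OF assms(1) that \<open>j < n\<close>] Suc.prems(1) by blast
    show "Ck_on n r V (pd c j f)"
      using Suc.prems(2) that by auto
  qed
  moreover have "line_in c j g z differentiable (at 0)" if "j < n" "c \<in> {1, \<i>}" "z \<in> V" for c j z
    using differentiable_line_in_cong[OF assms(1) \<open>z \<in> V\<close> \<open>j < n\<close>, of f g c] Suc.prems that by auto
  moreover have "continuous_on V g"
    using Suc.prems(2) by (subst continuous_on_cong[OF refl Suc.prems(1)[symmetric]]) auto
  ultimately show ?case by auto
qed

lemma smooth_on_cong:
  assumes "openin (top_of_set (cspace n)) V" "\<And>w. w \<in> V \<Longrightarrow> f w = g w" "smooth_on n V f"
  shows "smooth_on n V g"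
  using assms Ck_on_cong unfolding smooth_on_def by blast

lemma line_in_const: "line_in c j (\<lambda>z. a) z = (\<lambda>t. a)"
  by (simp add: line_in_def)

lemma pd_const [simp]: "pd c j (\<lambda>z. a) z = 0"
  by (simp add: pd_def line_in_const)

lemma dz_const [simp]: "dz j (\<lambda>z. a) z = 0"
  by (simp add: dz_def)

lemma dzbar_const [simp]: "dzbar j (\<lambda>z. a) z = 0"
  by (simp add: dzbar_def)

lemma Ck_on_const: "Ck_on n r V (\<lambda>z. a)"
proof (induction r arbitrary: a)
  case (Suc r)
  have "pd c j (\<lambda>z. a) = (\<lambda>z. 0)" for c j
    by (rule ext) simp
  then show ?case
    using Suc by (simp add: line_in_const)
qed simp

lemma smooth_on_const: "smooth_on n V (\<lambda>z. a)"
  by (simp add: smooth_on_def Ck_on_const)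

lemma dz_coordinate: "dz j (\<lambda>z. z i) z = (if i = j then 1 else 0)"
proof -
  have *: "vector_derivative (\<lambda>t. a + complex_of_real t * c) (at 0) = c" for a c
    by (rule vector_derivative_at) (auto intro!: derivative_eq_intros simp: has_vector_derivative_def scaleR_conv_of_real)
  have "pd c j (\<lambda>z. z i) z = (if i = j then c else 0)" for c
    by (cases "i = j") (simp_all add: pd_def line_in_def *)
  then show ?thesis
    by (simp add: dz_def)
qed

text \<open>
  \<open>\<phi>\<close> depends on the j-th coordinate only through its own coordinate \<open>\<tau> j\<close>, which is a copy
  of the j-th one (or not at all, for \<open>\<tau> j = None\<close>).
\<close>

definition coord_subst ::
  "nat \<Rightarrow> nat \<Rightarrow> (nat \<Rightarrow> nat option) \<Rightarrow> ((nat \<Rightarrow> complex) \<Rightarrow> (nat \<Rightarrow> complex)) \<Rightarrow> bool" where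
  "coord_subst n N \<tau> \<phi> \<longleftrightarrow> continuous_on UNIV \<phi> \<and>
     (\<forall>j<n. case \<tau> j of None \<Rightarrow> \<forall>z v. \<phi> (z(j := v)) = \<phi> z
        | Some i \<Rightarrow> i < N \<and> (\<forall>z v. \<phi> (z(j := v)) = (\<phi> z)(i := v) \<and> \<phi> z i = z j))"

text \<open>The substitution maps a coordinate line to a coordinate line or to a point. So the chain
  rule becomes an equality of functions of \<open>t\<close>, valid for every
  \<open>F\<close>.\<close>

lemma line_in_subst:
  assumes "coord_subst n N \<tau> \<phi>" "j < n"
  shows "line_in c j (\<lambda>z. F (\<phi> z)) z =
    (case \<tau> j of None \<Rightarrow> (\<lambda>t. F (\<phi> z)) | Some i \<Rightarrow> line_in c i F (\<phi> z))"
  using assms by (auto simp: coord_subst_def line_in_def split: option.splits)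

lemma pd_subst:
  assumes "coord_subst n N \<tau> \<phi>" "j < n"
  shows "pd c j (\<lambda>z. F (\<phi> z)) z = (case \<tau> j of None \<Rightarrow> 0 | Some i \<Rightarrow> pd c i F (\<phi> z))"
  unfolding pd_def line_in_subst[OF assms] by (auto split: option.splits)

lemma dz_subst:
  assumes "coord_subst n N \<tau> \<phi>" "j < n"
  shows "dz j (\<lambda>z. F (\<phi> z)) z = (case \<tau> j of None \<Rightarrow> 0 | Some i \<Rightarrow> dz i F (\<phi> z))"
  unfolding dz_def pd_subst[OF assms] by (auto split: option.splits)

lemma dzbar_subst:
  assumes "coord_subst n N \<tau> \<phi>" "j < n"
  shows "dzbar j (\<lambda>z. F (\<phi> z)) z = (case \<tau> j of None \<Rightarrow> 0 | Some i \<Rightarrow> dzbar i F (\<phi> z))"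
  unfolding dzbar_def pd_subst[OF assms] by (auto split: option.splits)

text \<open>Each derivative of the composition is 0 or again a composition with \<phi>, so the
  induction on the order closes when \<open>F\<close> is kept arbitrary.\<close>

lemma Ck_on_subst:
  assumes \<phi>: "coord_subst n N \<tau> \<phi>" and im: "\<And>z. z \<in> V' \<Longrightarrow> \<phi> z \<in> V"
  shows "Ck_on N r V F \<Longrightarrow> Ck_on n r V' (\<lambda>z. F (\<phi> z))"
proof -
  have cont: "continuous_on V' (\<lambda>z. F (\<phi> z))" if "continuous_on V F" for F :: "_ \<Rightarrow> complex"
  proof -
    have "continuous_on V' \<phi>"
      using \<phi> by (auto simp: coord_subst_def intro: continuous_on_subset)
    then show ?thesis
      using continuous_on_compose2[OF that] im by blast
  qed
  show "Ck_on N r V F \<Longrightarrow> Ck_on n r V' (\<lambda>z. F (\<phi> z))"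
  proof (induction r arbitrary: F)
    case 0
    then show ?case using cont by simp
  next
    case (Suc r)
    have "(\<forall>z\<in>V'. line_in c j (\<lambda>z. F (\<phi> z)) z differentiable (at 0)) \<and>
          Ck_on n r V' (pd c j (\<lambda>z. F (\<phi> z)))" if j: "j < n" and c: "c \<in> {1, \<i>}" for c j
    proof (cases "\<tau> j")
      case None
      have "pd c j (\<lambda>z. F (\<phi> z)) = (\<lambda>z. 0)"
        by (rule ext) (simp add: pd_subst[OF \<phi> j] None)
      then show ?thesis
        by (simp add: line_in_subst[OF \<phi> j] None Ck_on_const)
    next
      case (Some i)
      then have i: "i < N"
        using \<phi> j by (auto simp: coord_subst_def split: option.splits)
      have "pd c j (\<lambda>z. F (\<phi> z)) = (\<lambda>z. pd c i F (\<phi> z))"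
        by (rule ext) (simp add: pd_subst[OF \<phi> j] Some)
      then show ?thesis
        using Suc.IH[of "pd c i F"] Suc.prems i c im
        by (auto simp: line_in_subst[OF \<phi> j] Some)
    qed
    then show ?case
      using cont Suc.prems by simp
  qed
qed

lemma smooth_on_subst:
  assumes "coord_subst n N \<tau> \<phi>" "\<And>z. z \<in> V' \<Longrightarrow> \<phi> z \<in> V" "smooth_on N V F"
  shows "smooth_on n V' (\<lambda>z. F (\<phi> z))"
  using assms Ck_on_subst unfolding smooth_on_def by blast

section \<open>Antiholomorphic functions\<close>

text \<open>Existence of both partial derivatives and continuity of \<open>B\<close> give real
  differentiability. The equation \<open>A t = \<i> * B t\<close> then says that the real derivative
  is \<open>A t\<close> times the conjugate of the increment, so conjugation makes it complex
  linear.\<close>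

lemma C1_cauchy_riemann_antiholomorphic:
  fixes G A B :: "complex \<Rightarrow> complex"
  assumes S: "open S"
    and A: "\<And>t. t \<in> S \<Longrightarrow> ((\<lambda>s. G (t + of_real s)) has_vector_derivative A t) (at 0)"
    and B: "\<And>t. t \<in> S \<Longrightarrow> ((\<lambda>s. G (t + of_real s * \<i>)) has_vector_derivative B t) (at 0)"
    and cB: "continuous_on S B"
    and CR: "\<And>t. t \<in> S \<Longrightarrow> A t = \<i> * B t"
  shows "(\<lambda>t. cnj (G t)) holomorphic_on S"
proof -
  have "((\<lambda>t. cnj (G t)) has_field_derivative cnj (A t0)) (at t0)" if t0: "t0 \<in> S" for t0
  proof -
    define x0 y0 where xy: "x0 = Re t0" "y0 = Im t0"
    obtain e where e: "e > 0" "ball t0 e \<subseteq> S"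
      using S t0 openE by blast
    \<comment> \<open>Partial derivatives are combined on a rectangle. Half the radius keeps it
      inside the ball, because the modulus is at most the sum of the absolute values of the real and
      imaginary parts.\<close>
    define X Y where XY: "X = ball x0 (e/2)" "Y = ball y0 (e/2)"
    have inS: "Complex x y \<in> S" if "x \<in> X" "y \<in> Y" for x y
    proof -
      have "dist t0 (Complex x y) \<le> \<bar>x0 - x\<bar> + \<bar>y0 - y\<bar>"
        unfolding dist_complex_def by (rule order_trans[OF cmod_le]) (simp add: xy)
      also have "\<dots> < e"
        using that by (simp add: XY dist_real_def)
      finally show ?thesis using e by auto
    qed
    have x0: "x0 \<in> X" and y0: "y0 \<in> Y" and t0c: "Complex x0 y0 = t0"
      using e by (auto simp: XY xy)
    \<comment> \<open>The hypotheses differentiate at \<open>s = 0\<close>; composing with this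
      translation moves the derivative to the actual coordinate.\<close>
    have shift: "((\<lambda>x::real. x + - a) has_derivative (\<lambda>h. h)) (at a)" for a
      using has_derivative_add[OF has_derivative_ident has_derivative_const[of "- a"], of "at a"] by simp
    define fx where "fx = (\<lambda>h::real. h *\<^sub>R A t0)"
    \<comment> \<open>The criterion for differentiability takes the first partial derivative at the
      point and the second one on the whole rectangle, as a continuous family of bounded linear
      maps.\<close>
    define fy where "fy = (\<lambda>(x::real) (y::real). blinfun_scaleR_left (B (Complex x y)))"
    have D: "((\<lambda>(x, y). G (Complex x y)) has_derivative (\<lambda>(tx, ty). fx tx + blinfun_apply (fy x0 y0) ty))
          (at (x0, y0) within X \<times> Y)"
    proof (rule has_derivative_partialsI)
      have "((\<lambda>s. G (t0 + of_real s)) has_derivative fx) (at 0)"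
        using A[OF t0] by (simp add: has_vector_derivative_def fx_def)
      then have "((\<lambda>s. G (t0 + of_real s)) has_derivative fx) (at (x0 + - x0))"
        by simp
      from has_derivative_compose[OF shift[of x0] this]
      have "((\<lambda>x. G (t0 + of_real (x + - x0))) has_derivative fx) (at x0)" .
      moreover have "t0 + of_real (x + - x0) = Complex x y0" for x
        by (simp add: complex_eq_iff xy)
      ultimately show "((\<lambda>x. G (Complex x y0)) has_derivative fx) (at x0 within X)"
        by (simp only: has_derivative_at_withinI)
    next
      fix x y assume "x \<in> X" "y \<in> Y"
      then have "((\<lambda>s. G (Complex x y + of_real s * \<i>)) has_derivative blinfun_apply (fy x y)) (at (y + - y))"
        using B[OF inS[of x y]] by (simp add: has_vector_derivative_def fy_def)
      from has_derivative_compose[OF shift[of y] this]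
      have "((\<lambda>s. G (Complex x y + of_real (s + - y) * \<i>)) has_derivative blinfun_apply (fy x y)) (at y)" .
      moreover have "Complex x y + of_real (s + - y) * \<i> = Complex x s" for s
        by (simp add: complex_eq_iff)
      ultimately show "((\<lambda>y. G (Complex x y)) has_derivative blinfun_apply (fy x y)) (at y within Y)"
        by (simp only: has_derivative_at_withinI)
    next
      have "continuous_on (X \<times> Y) (\<lambda>p. B (Complex (fst p) (snd p)))"
        by (rule continuous_on_compose2[OF cB]) (use inS in \<open>auto intro!: continuous_intros\<close>)
      then have "continuous_on (X \<times> Y) (\<lambda>p. blinfun_scaleR_left (B (Complex (fst p) (snd p))))"
        by (rule bounded_linear.continuous_on[OF bounded_linear_blinfun_scaleR_left])
      then show "continuous (at (x0, y0) within X \<times> Y) (\<lambda>(x, y). fy x y)"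
        using x0 y0 by (simp add: continuous_on_eq_continuous_within fy_def case_prod_unfold)
    next
      show "y0 \<in> Y" by (rule y0)
      show "convex Y" by (simp add: XY)
    qed
    have "at (x0, y0) within X \<times> Y = at (x0, y0)"
      using x0 y0 by (intro at_within_open open_Times) (auto simp: XY)
    with D have *: "((\<lambda>p. G (Complex (fst p) (snd p))) has_derivative (\<lambda>(tx, ty). fx tx + blinfun_apply (fy x0 y0) ty))
          (at (Re t0, Im t0))"
      by (simp only: case_prod_unfold xy)
    have "((\<lambda>t. (Re t, Im t)) has_derivative (\<lambda>t. (Re t, Im t))) (at t0)"
      by (intro has_derivative_Pair has_derivative_Re has_derivative_Im has_derivative_ident)
    from has_derivative_compose[OF this *]
    have "(G has_derivative (\<lambda>h. Re h *\<^sub>R A t0 + Im h *\<^sub>R B t0)) (at t0)"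
      by (simp add: fx_def fy_def t0c)
    then have "((\<lambda>t. cnj (G t)) has_derivative (\<lambda>h. cnj (Re h *\<^sub>R A t0 + Im h *\<^sub>R B t0))) (at t0)"
      by (rule has_derivative_cnj)
    moreover have "cnj (Re h *\<^sub>R A t0 + Im h *\<^sub>R B t0) = cnj (A t0) * h" for h
      by (simp add: CR[OF t0] complex_eq_iff algebra_simps)
    ultimately show ?thesis
      by (simp add: has_field_derivative_def)
  qed
  then show ?thesis
    using S by (auto simp: holomorphic_on_open)
qed

text \<open>Vanishing of \<open>dz j F\<close> is the Cauchy-Riemann equation between the two real
  partial derivatives, so the one-variable result applies along the j-th coordinate. The set
  \<open>S\<close> holds the values of that coordinate which stay in \<open>V\<close>.\<close>

lemma antiholomorphic_in_each_coordinate: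
  assumes F: "smooth_on n V F" and D: "\<And>z. z \<in> V \<Longrightarrow> dz j F z = 0" and j: "j < n"
    and S: "open S" "\<And>t. t \<in> S \<Longrightarrow> z(j := t) \<in> V"
  shows "(\<lambda>t. cnj (F (z(j := t)))) holomorphic_on S"
proof (rule C1_cauchy_riemann_antiholomorphic[OF S(1)])
  have C1: "Ck_on n (Suc 0) V F"
    using F unfolding smooth_on_def by blast
  have der: "(line_in c j F w has_vector_derivative pd c j F w) (at 0)" if "w \<in> V" "c \<in> {1, \<i>}" for c w
    using C1 that j by (auto simp: pd_def vector_derivative_works[symmetric])
  fix t assume t: "t \<in> S"
  show "((\<lambda>s. F (z(j := t + of_real s))) has_vector_derivative pd 1 j F (z(j := t))) (at 0)"
    using der[OF S(2)[OF t], of 1] by (simp add: line_in_def)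
  show "((\<lambda>s. F (z(j := t + of_real s * \<i>))) has_vector_derivative pd \<i> j F (z(j := t))) (at 0)"
    using der[OF S(2)[OF t], of \<i>] by (simp add: line_in_def)
  show "pd 1 j F (z(j := t)) = \<i> * pd \<i> j F (z(j := t))"
    using D[OF S(2)[OF t]] by (simp add: dz_def)
next
  have "continuous_on V (pd \<i> j F)"
    using F[unfolded smooth_on_def, rule_format, of "Suc 0"] j by simp
  moreover have "continuous_on S (\<lambda>t. z(j := t))"
    by (intro continuous_on_coordinate_update continuous_intros)
  ultimately show "continuous_on S (\<lambda>t. pd \<i> j F (z(j := t)))"
    by (rule continuous_on_compose2) (use S(2) in auto)
qed

text \<open>Basic open sets restrict each coordinate separately, and in \<open>cspace n\<close> only
  the first \<open>n\<close> coordinates vary. Hence the minimum of finitely many radii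
  works.\<close>

lemma polydisc_in_open:
  assumes V: "openin (top_of_set (cspace n)) V" and w: "w \<in> V"
  obtains e where "e > 0" "\<And>z. z \<in> cspace n \<Longrightarrow> (\<And>i. i < n \<Longrightarrow> dist (w i) (z i) < e) \<Longrightarrow> z \<in> V"
proof -
  obtain U where U: "open U" "V = cspace n \<inter> U"
    using V by (auto simp: openin_open)
  have "openin (product_topology (\<lambda>i. euclidean) UNIV) U"
    using U(1) by (simp add: open_fun_def)
  from product_topology_open_contains_basis[OF this, of w]
  obtain X where X: "w \<in> (\<Pi>\<^sub>E i\<in>UNIV. X i)" "\<And>i. open (X i)" "(\<Pi>\<^sub>E i\<in>UNIV. X i) \<subseteq> U"
    using w U by auto
  have wX: "w i \<in> X i" for i
    using X(1) by auto
  then have "\<forall>i. \<exists>e>0. ball (w i) e \<subseteq> X i"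
    using X(2) open_contains_ball by blast
  then obtain e where e: "\<And>i. e i > 0" "\<And>i. ball (w i) (e i) \<subseteq> X i"
    by metis
  show ?thesis
  proof
    \<comment> \<open>Inserting 1 keeps the set nonempty for \<open>n = 0\<close>.\<close>
    show "Min (insert 1 (e ` {..<n})) > 0"
      using e(1) by (subst Min_gr_iff) auto
    fix z assume z: "z \<in> cspace n" "\<And>i. i < n \<Longrightarrow> dist (w i) (z i) < Min (insert 1 (e ` {..<n}))"
    have "z i \<in> X i" for i
    proof (cases "i < n")
      case True
      then have "z i \<in> ball (w i) (e i)"
        using z(2)[OF True] by auto
      then show ?thesis using e(2) by blast
    next
      case False
      then have "z i = w i"
        using z(1) w U by (auto simp: cspace_def)
      then show ?thesis using wX by simp
    qed
    then show "z \<in> V"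
      using X(3) z(1) U by auto
  qed
qed

text \<open>
  Changing one coordinate at a time reduces this to the maximum principle in one variable.
\<close>

lemma antiholomorphic_max_locally_constant:
  assumes V: "openin (top_of_set (cspace n)) V" and w: "w \<in> V"
    and F: "smooth_on n V F" and D: "\<And>z j. z \<in> V \<Longrightarrow> j < n \<Longrightarrow> dz j F z = 0"
    and max: "\<And>z. z \<in> V \<Longrightarrow> norm (F z) \<le> norm (F w)"
  shows "\<exists>U. openin (top_of_set (cspace n)) U \<and> w \<in> U \<and> U \<subseteq> V \<and> (\<forall>z\<in>U. F z = F w)"
proof -
  obtain e where e: "e > 0"
    "\<And>z. z \<in> cspace n \<Longrightarrow> (\<And>i. i < n \<Longrightarrow> dist (w i) (z i) < e) \<Longrightarrow> z \<in> V"
    using polydisc_in_open[OF V w] by blast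
  define U where "U = {z \<in> cspace n. \<forall>i<n. dist (w i) (z i) < e}"
  have UV: "U \<subseteq> V"
    using e(2) by (auto simp: U_def)
  have wc: "w \<in> cspace n"
    using V w by (auto simp: openin_open)
  \<comment> \<open>The number \<open>m\<close> bounds the initial coordinates in which
    \<open>z\<close> may differ from \<open>w\<close>; the induction moves one more of them at a
    time.\<close>
  have const: "F z = F w" if "z \<in> U" "\<forall>i\<ge>m. z i = w i" "m \<le> n" for m z
    using that
  proof (induction m arbitrary: z)
    case 0
    then have "z = w" by auto
    then show ?case by simp
  next
    case (Suc m)
    define z' where "z' = z(m := w m)"
    have m: "m < n" using Suc.prems by simp
    have "z' \<in> U"
      using Suc.prems m wc e(1) by (auto simp: z'_def U_def cspace_def)
    moreover have "\<forall>i\<ge>m. z' i = w i"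
      using Suc.prems(2) by (auto simp: z'_def Suc_le_eq)
    ultimately have Fz': "F z' = F w"
      using Suc.IH[of z'] m by simp
    \<comment> \<open>Conjugation makes the slice of \<open>F\<close> holomorphic. By the induction
      hypothesis its value at \<open>w m\<close> has norm \<open>norm (F w)\<close>, so
      \<open>max\<close> makes \<open>w m\<close> a maximum point.\<close>
    define G where "G = (\<lambda>t. cnj (F (z(m := t))))"
    have inU: "z(m := t) \<in> U" if "t \<in> ball (w m) e" for t
      using that Suc.prems m by (auto simp: U_def cspace_def)
    have "G holomorphic_on ball (w m) e"
      unfolding G_def
      by (rule antiholomorphic_in_each_coordinate[OF F D m]) (use m inU UV in auto)
    moreover have "norm (G t) \<le> norm (G (w m))" if "t \<in> ball (w m) e" for t
      using max[of "z(m := t)"] inU[OF that] UV Fz' by (auto simp: G_def z'_def)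
    ultimately have "G constant_on ball (w m) e"
      using e(1) by (intro maximum_modulus_principle[of G _ "ball (w m) e" "w m"]) auto
    moreover have "z m \<in> ball (w m) e" "w m \<in> ball (w m) e"
      using Suc.prems m e(1) by (auto simp: U_def)
    ultimately have "G (z m) = G (w m)"
      by (auto simp: constant_on_def)
    then show ?case
      using Fz' by (simp add: G_def z'_def)
  qed
  show ?thesis
  proof (intro exI conjI ballI)
    have "open {z::nat \<Rightarrow> complex. \<forall>i\<in>{..<n}. z i \<in> ball (w i) e}"
      by (rule product_topology_basis') auto
    moreover have "U = cspace n \<inter> {z. \<forall>i\<in>{..<n}. z i \<in> ball (w i) e}"
      by (auto simp: U_def)
    ultimately show "openin (top_of_set (cspace n)) U"
      by (auto simp: openin_open)
    show "w \<in> U" using wc e(1) by (simp add: U_def)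
    show "U \<subseteq> V" by (rule UV)
    show "F z = F w" if "z \<in> U" for z
      using const[OF that, of n] that wc by (auto simp: U_def cspace_def)
  qed
qed

section \<open>Charts\<close>

lemma overlap_self: "overlap c c = chart_image c"
  by (simp add: overlap_def chart_image_def)

lemma overlap_subset: "overlap c d \<subseteq> chart_image c"
  by (auto simp: overlap_def chart_image_def)

lemma chart_change_self: "z \<in> chart_image c \<Longrightarrow> chart_change c c z = z"
  by (simp add: chart_change_def chart_image_def f_inv_into_f)

lemma chart_inj:
  assumes "is_chart T n c"
  shows "inj_on (snd c) (fst c)"
proof -
  have "fst c \<subseteq> topspace T"
    using assms by (simp add: is_chart_def openin_subset)
  then have "topspace (subtopology T (fst c)) = fst c"
    by (simp add: topspace_subtopology Int_absorb1)
  then show ?thesis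
    using assms homeomorphic_imp_injective_map unfolding is_chart_def by metis
qed

lemma chart_change_apply:
  assumes "is_chart T n c" "x \<in> fst c"
  shows "chart_change c d (snd c x) = snd d x"
  using chart_inj[OF assms(1)] assms(2) by (simp add: chart_change_def)

lemma chart_open_image:
  assumes c: "is_chart T n c" and U: "openin T U" "U \<subseteq> fst c"
  shows "openin (top_of_set (cspace n)) (snd c ` U)"
proof -
  have "open_map (subtopology T (fst c)) (top_of_set (chart_image c)) (snd c)"
    using c homeomorphic_imp_open_map by (auto simp: is_chart_def)
  moreover have "openin (subtopology T (fst c)) U"
    using U c by (simp add: openin_open_subtopology is_chart_def)
  ultimately have "openin (top_of_set (chart_image c)) (snd c ` U)"
    by (simp add: open_map_def)
  moreover have "openin (top_of_set (cspace n)) (chart_image c)"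
    using c by (simp add: is_chart_def)
  ultimately show ?thesis
    by (rule openin_trans)
qed

lemma chart_open_vimage:
  assumes c: "is_chart T n c" and U: "openin (top_of_set (cspace n)) U" "U \<subseteq> chart_image c"
  shows "openin T {x \<in> fst c. snd c x \<in> U}"
proof -
  have fc: "openin T (fst c)" "fst c \<subseteq> topspace T"
    using c by (auto simp: is_chart_def openin_subset)
  have "continuous_map (subtopology T (fst c)) (top_of_set (chart_image c)) (snd c)"
    using c homeomorphic_imp_continuous_map by (auto simp: is_chart_def)
  moreover have "chart_image c \<subseteq> cspace n"
    using c by (auto simp: is_chart_def dest: openin_imp_subset)
  then have "openin (top_of_set (chart_image c)) U"
    using U by (meson openin_subset_trans)
  ultimately have "openin (subtopology T (fst c)) {x \<in> topspace (subtopology T (fst c)). snd c x \<in> U}"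
    by (rule openin_continuous_map_preimage)
  then show ?thesis
    using fc by (simp add: openin_open_subtopology topspace_subtopology Int_absorb1)
qed

lemma atlas_is_chart:
  "complex_manifold M \<Longrightarrow> c \<in> atlas M \<Longrightarrow> is_chart (mtop M) (mdim M) c"
  by (simp add: complex_manifold_def)

lemma overlap_open:
  assumes "complex_manifold M" "c \<in> atlas M" "d \<in> atlas M"
  shows "openin (top_of_set (cspace (mdim M))) (overlap c d)"
proof -
  have "openin (mtop M) (fst c \<inter> fst d)"
    using atlas_is_chart[OF assms(1)] assms(2,3) unfolding is_chart_def by blast
  then show ?thesis
    unfolding overlap_def using chart_open_image[OF atlas_is_chart[OF assms(1,2)]] by blast
qed

lemma chart_image_open:
  assumes "complex_manifold M" "c \<in> atlas M"
  shows "openin (top_of_set (cspace (mdim M))) (chart_image c)"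
  using overlap_open[OF assms assms(2)] by (simp add: overlap_self)

lemma chart_image_cspace:
  assumes "complex_manifold M" "c \<in> atlas M"
  shows "chart_image c \<subseteq> cspace (mdim M)"
  using chart_image_open[OF assms] by (rule openin_imp_subset)

lemma chart_change_mem:
  assumes "complex_manifold M" "c \<in> atlas M" "z \<in> overlap c d"
  shows "chart_change c d z \<in> chart_image d"
proof -
  obtain x where "x \<in> fst c" "x \<in> fst d" "z = snd c x"
    using assms(3) by (auto simp: overlap_def)
  then show ?thesis
    using chart_change_apply[OF atlas_is_chart[OF assms(1,2)]] by (simp add: chart_image_def)
qed

text \<open>The projection from the coordinates of a product to those of the factor whose block
  starts at \<open>m\<close>. The zeros from \<open>n\<close> on place the result in
  \<open>cspace n\<close>.\<close>

definition coords :: "nat \<Rightarrow> nat \<Rightarrow> (nat \<Rightarrow> complex) \<Rightarrow> nat \<Rightarrow> complex" where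
  "coords m n z = (\<lambda>i. if i < n then z (m + i) else 0)"

lemma coords_cspace: "coords m n z \<in> cspace n"
  by (simp add: coords_def cspace_def)

lemma cspace_eqI_coords:
  assumes "z \<in> cspace (n + l)" "w \<in> cspace (n + l)"
    and "coords 0 n z = coords 0 n w" "coords n l z = coords n l w"
  shows "z = w"
proof
  fix i
  consider "i < n" | "n \<le> i" "i - n < l" | "n + l \<le> i" by linarith
  then show "z i = w i"
  proof cases
    case 1
    then show ?thesis using fun_cong[OF assms(3), of i] by (simp add: coords_def)
  next
    case 2
    then show ?thesis using fun_cong[OF assms(4), of "i - n"] by (simp add: coords_def)
  next
    case 3
    then show ?thesis using assms(1,2) by (simp add: cspace_def)
  qed
qed

lemma snd_prod_chart:
  assumes "is_chart T n c" "is_chart T' l c'" "x \<in> fst c" "y \<in> fst c'"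
  shows "snd (prod_chart n c c') (x, y) \<in> cspace (n + l)"
    and "coords 0 n (snd (prod_chart n c c') (x, y)) = snd c x"
    and "coords n l (snd (prod_chart n c c') (x, y)) = snd c' y"
proof -
  have "chart_image c \<subseteq> cspace n" "chart_image c' \<subseteq> cspace l"
    using assms(1,2) by (auto simp: is_chart_def dest: openin_imp_subset)
  then have *: "snd c x \<in> cspace n" "snd c' y \<in> cspace l"
    using assms(3,4) by (auto simp: chart_image_def)
  show "snd (prod_chart n c c') (x, y) \<in> cspace (n + l)"
    using * by (auto simp: prod_chart_def cspace_def)
  show "coords 0 n (snd (prod_chart n c c') (x, y)) = snd c x"
    using * by (auto simp: prod_chart_def cspace_def coords_def)
  show "coords n l (snd (prod_chart n c c') (x, y)) = snd c' y"
    using * by (auto simp: prod_chart_def cspace_def coords_def)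
qed

text \<open>A point of \<open>cspace (n + l)\<close> is determined by its two blocks, so overlaps
  are products. Taking the charts equal in pairs also describes chart images, by
  \<open>overlap_self\<close>.\<close>

lemma overlap_prod_chart:
  assumes "is_chart T n c" "is_chart T' l c'" "is_chart T n d" "is_chart T' l d'"
  shows "overlap (prod_chart n c c') (prod_chart n d d') =
    {z \<in> cspace (n + l). coords 0 n z \<in> overlap c d \<and> coords n l z \<in> overlap c' d'}" (is "?A = ?B")
proof
  show "?A \<subseteq> ?B"
  proof
    fix z assume "z \<in> ?A"
    then obtain x y where "x \<in> fst c \<inter> fst d" "y \<in> fst c' \<inter> fst d'" "z = snd (prod_chart n c c') (x, y)"
      by (auto simp: overlap_def prod_chart_def)
    then show "z \<in> ?B"
      using snd_prod_chart[OF assms(1,2), of x y] by (auto simp: overlap_def)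
  qed
  show "?B \<subseteq> ?A"
  proof
    fix z assume z: "z \<in> ?B"
    then obtain x y where xy: "x \<in> fst c \<inter> fst d" "y \<in> fst c' \<inter> fst d'"
        "coords 0 n z = snd c x" "coords n l z = snd c' y"
      by (auto simp: overlap_def)
    have "z = snd (prod_chart n c c') (x, y)"
      by (rule cspace_eqI_coords[of _ n l]) (use z xy snd_prod_chart[OF assms(1,2), of x y] in auto)
    moreover have "(x, y) \<in> fst (prod_chart n c c') \<inter> fst (prod_chart n d d')"
      using xy by (auto simp: prod_chart_def)
    ultimately show "z \<in> ?A"
      by (simp add: overlap_def)
  qed
qed

lemma inj_on_prod_chart:
  assumes "is_chart T n c" "is_chart T' l c'"
  shows "inj_on (snd (prod_chart n c c')) (fst (prod_chart n c c'))"
proof (rule inj_onI)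
  fix p q assume pq: "p \<in> fst (prod_chart n c c')" "q \<in> fst (prod_chart n c c')"
    "snd (prod_chart n c c') p = snd (prod_chart n c c') q"
  obtain x y x' y' where [simp]: "p = (x, y)" "q = (x', y')"
    by fastforce
  have xy: "x \<in> fst c" "x' \<in> fst c" "y \<in> fst c'" "y' \<in> fst c'"
    using pq(1,2) by (auto simp: prod_chart_def)
  have "snd c x = snd c x'" "snd c' y = snd c' y'"
    using snd_prod_chart[OF assms, of x y] snd_prod_chart[OF assms, of x' y'] xy pq(3) by auto
  then show "p = q"
    using chart_inj[OF assms(1)] chart_inj[OF assms(2)] xy by (auto dest: inj_onD)
qed

text \<open>A product chart is injective, so the inverse inside \<open>chart_change\<close> returns
  the pair of points that serves both factors.\<close>

lemma chart_change_prod_chart: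
  assumes "is_chart T n c" "is_chart T' l c'" "is_chart T n d" "is_chart T' l d'"
    and z: "z \<in> overlap (prod_chart n c c') (prod_chart n d d')"
  shows "chart_change (prod_chart n c c') (prod_chart n d d') z \<in> cspace (n + l)"
    and "coords 0 n (chart_change (prod_chart n c c') (prod_chart n d d') z) = chart_change c d (coords 0 n z)"
    and "coords n l (chart_change (prod_chart n c c') (prod_chart n d d') z) = chart_change c' d' (coords n l z)"
proof -
  obtain x y where xy: "x \<in> fst c" "x \<in> fst d" "y \<in> fst c'" "y \<in> fst d'"
      "z = snd (prod_chart n c c') (x, y)"
    using z by (auto simp: overlap_def prod_chart_def)
  have "(x, y) \<in> fst (prod_chart n c c')"
    using xy by (simp add: prod_chart_def)
  then have *: "chart_change (prod_chart n c c') (prod_chart n d d') z = snd (prod_chart n d d') (x, y)"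
    using inj_on_prod_chart[OF assms(1,2)] xy(5) by (simp add: chart_change_def)
  show "chart_change (prod_chart n c c') (prod_chart n d d') z \<in> cspace (n + l)"
    unfolding * using xy assms(1-4) by (simp add: snd_prod_chart)
  show "coords 0 n (chart_change (prod_chart n c c') (prod_chart n d d') z) = chart_change c d (coords 0 n z)"
    unfolding * using xy assms(1-4)
    by (simp add: snd_prod_chart chart_change_apply[OF assms(1)])
  show "coords n l (chart_change (prod_chart n c c') (prod_chart n d d') z) = chart_change c' d' (coords n l z)"
    unfolding * using xy assms(1-4)
    by (simp add: snd_prod_chart chart_change_apply[OF assms(2)])
qed

text \<open>
  A product chart does not determine its factors outside of their domains.
\<close>

lemma prod_chart_eqD:
  assumes "is_chart T n c" "is_chart T' l c'" "is_chart T n d" "is_chart T' l d'"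
    and eq: "prod_chart n c c' = prod_chart n d d'" and ne: "fst (prod_chart n c c') \<noteq> {}"
  shows "fst c = fst d" "x \<in> fst c \<Longrightarrow> snd c x = snd d x"
    and "fst c' = fst d'" "y \<in> fst c' \<Longrightarrow> snd c' y = snd d' y"
proof -
  have "fst c \<times> fst c' = fst d \<times> fst d'"
    using arg_cong[OF eq, of fst] by (simp add: prod_chart_def)
  then show *: "fst c = fst d" "fst c' = fst d'"
    using ne by (auto simp: prod_chart_def times_eq_iff)
  obtain x0 y0 where 0: "x0 \<in> fst c" "y0 \<in> fst c'"
    using ne by (auto simp: prod_chart_def)
  show "snd c x = snd d x" if "x \<in> fst c"
    using snd_prod_chart(2)[OF assms(1,2) that 0(2)] snd_prod_chart(2)[OF assms(3,4), of x y0] that 0 * eq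
    by simp
  show "snd c' y = snd d' y" if "y \<in> fst c'"
    using snd_prod_chart(3)[OF assms(1,2) 0(1) that] snd_prod_chart(3)[OF assms(3,4), of x0 y] that 0 * eq
    by simp
qed

section \<open>Liouville's theorem\<close>

text \<open>Compactness gives a maximum point of the norm, and connectedness spreads the value taken
  there. The function is given by its expressions \<open>g c\<close> in the charts, because the
  application supplies coefficients chart by chart.\<close>

lemma antiholomorphic_function_constant:
  assumes M: "compact_connected_complex_manifold M"
    and smooth: "\<And>c. c \<in> atlas M \<Longrightarrow> smooth_on (mdim M) (chart_image c) (g c)"
    and dz0: "\<And>c z j. c \<in> atlas M \<Longrightarrow> z \<in> chart_image c \<Longrightarrow> j < mdim M \<Longrightarrow> dz j (g c) z = 0"
    and glue: "\<And>c d x. c \<in> atlas M \<Longrightarrow> d \<in> atlas M \<Longrightarrow> x \<in> fst c \<Longrightarrow> x \<in> fst d \<Longrightarrow>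
      g c (snd c x) = g d (snd d x)"
    and c: "c \<in> atlas M" "z \<in> chart_image c" and d: "d \<in> atlas M" "w \<in> chart_image d"
  shows "g c z = g d w"
proof -
  have cm: "complex_manifold M" and comp: "compact_space (mtop M)" and conn: "connected_space (mtop M)"
    using M by (auto simp: compact_connected_complex_manifold_def)
  let ?T = "mtop M" and ?n = "mdim M"
  have cover: "(\<Union>c\<in>atlas M. fst c) = topspace ?T"
    using cm by (simp add: complex_manifold_def)
  note chart = atlas_is_chart[OF cm]
  \<comment> \<open>By \<open>glue\<close> the local expressions agree at common points, so every
    chart around \<open>x\<close> yields the same value.\<close>
  define h where "h = (\<lambda>x. let c = (SOME c. c \<in> atlas M \<and> x \<in> fst c) in g c (snd c x))"
  have h: "h x = g c (snd c x)" if "c \<in> atlas M" "x \<in> fst c" for c x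
  proof -
    have "(SOME c. c \<in> atlas M \<and> x \<in> fst c) \<in> atlas M \<and> x \<in> fst (SOME c. c \<in> atlas M \<and> x \<in> fst c)"
      by (rule someI[of "\<lambda>c. c \<in> atlas M \<and> x \<in> fst c" c]) (use that in simp)
    then show ?thesis
      unfolding h_def Let_def using that by (intro glue) simp_all
  qed
  have cont: "continuous_on (chart_image c) (g c)" if "c \<in> atlas M" for c
    using smooth[OF that, unfolded smooth_on_def, rule_format, of 0] by simp
  have "openin ?T {x \<in> topspace ?T. h x \<in> U}" if U: "open U" for U
  proof -
    have "{x \<in> topspace ?T. h x \<in> U} =
        (\<Union>c\<in>atlas M. {x \<in> fst c. snd c x \<in> {z \<in> chart_image c. g c z \<in> U}})"
    proof (intro equalityI subsetI)
      fix x assume "x \<in> {x \<in> topspace ?T. h x \<in> U}"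
      then obtain c where "c \<in> atlas M" "x \<in> fst c" "h x \<in> U"
        using cover by blast
      then show "x \<in> (\<Union>c\<in>atlas M. {x \<in> fst c. snd c x \<in> {z \<in> chart_image c. g c z \<in> U}})"
        using h[of c x] by (intro UN_I[of c]) (simp_all add: chart_image_def)
    next
      fix x assume "x \<in> (\<Union>c\<in>atlas M. {x \<in> fst c. snd c x \<in> {z \<in> chart_image c. g c z \<in> U}})"
      then obtain c where c: "c \<in> atlas M" "x \<in> fst c" "g c (snd c x) \<in> U"
        by blast
      then have "x \<in> topspace ?T"
        using cover by blast
      then show "x \<in> {x \<in> topspace ?T. h x \<in> U}"
        using c h[of c x] by simp
    qed
    moreover have "openin ?T {x \<in> fst c. snd c x \<in> {z \<in> chart_image c. g c z \<in> U}}" if "c \<in> atlas M" for c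
    proof (rule chart_open_vimage[OF chart[OF that]])
      have "openin (top_of_set (chart_image c)) (chart_image c \<inter> g c -` U)"
        using cont[OF that] U by (rule continuous_openin_preimage_gen)
      then have "openin (top_of_set (chart_image c)) {z \<in> chart_image c. g c z \<in> U}"
        by (simp add: vimage_def Int_def)
      then show "openin (top_of_set (cspace ?n)) {z \<in> chart_image c. g c z \<in> U}"
        using chart_image_open[OF cm that] openin_trans by blast
    qed auto
    then have "openin ?T (\<Union>c\<in>atlas M. {x \<in> fst c. snd c x \<in> {z \<in> chart_image c. g c z \<in> U}})"
      by (intro openin_Union) (elim imageE, hypsubst)
    ultimately show ?thesis
      by (rule ssubst)
  qed
  then have hcont: "continuous_map ?T euclidean h"
    by (simp add: continuous_map_def)
  have "compactin euclidean (h ` topspace ?T)"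
    using image_compactin[OF _ hcont] comp by (simp add: compact_space_def)
  then have compact: "compact (norm ` h ` topspace ?T)"
    by (intro compact_continuous_image continuous_intros) simp
  obtain x1 y1 where x1: "x1 \<in> fst c" "z = snd c x1" and y1: "y1 \<in> fst d" "w = snd d y1"
    using c d by (auto simp: chart_image_def)
  then have top: "x1 \<in> topspace ?T" "y1 \<in> topspace ?T"
    using c d cover by blast+
  have "norm ` h ` topspace ?T \<noteq> {}"
    using top by blast
  then obtain x0 where x0: "x0 \<in> topspace ?T" "\<And>x. x \<in> topspace ?T \<Longrightarrow> norm (h x) \<le> norm (h x0)"
    using compact_attains_sup[OF compact] by blast
  \<comment> \<open>Every point of this level set is again a maximum point, so the local statement
    shows that the set is open; continuity shows that it is closed.\<close>
  define A where "A = {x \<in> topspace ?T. h x \<in> {h x0}}"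
  have "closedin ?T A"
    unfolding A_def by (rule closedin_continuous_map_preimage[OF hcont]) simp
  moreover have "openin ?T A"
  proof (subst openin_subopen, intro ballI)
    fix a assume a: "a \<in> A"
    then have "a \<in> topspace ?T" by (simp add: A_def)
    then obtain e where e: "e \<in> atlas M" "a \<in> fst e"
      using cover by blast
    have ha: "h a = h x0" using a by (simp add: A_def)
    have max: "norm (g e z) \<le> norm (g e (snd e a))" if "z \<in> chart_image e" for z
    proof -
      obtain x where "x \<in> fst e" "z = snd e x"
        using \<open>z \<in> chart_image e\<close> by (auto simp: chart_image_def)
      moreover from this have "x \<in> topspace ?T" using e cover by blast
      ultimately show ?thesis
        using x0(2)[of x] h[OF e(1) \<open>x \<in> fst e\<close>] h[OF e] ha by simp
    qed
    have mem: "snd e a \<in> chart_image e"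
      using e by (simp add: chart_image_def)
    have "\<exists>U. openin (top_of_set (cspace ?n)) U \<and> snd e a \<in> U \<and> U \<subseteq> chart_image e \<and>
        (\<forall>z\<in>U. g e z = g e (snd e a))"
      by (rule antiholomorphic_max_locally_constant[OF chart_image_open[OF cm e(1)] mem smooth[OF e(1)]])
        (simp_all add: dz0[OF e(1)] max)
    then obtain U where U: "openin (top_of_set (cspace ?n)) U" "snd e a \<in> U" "U \<subseteq> chart_image e"
        "\<forall>z\<in>U. g e z = g e (snd e a)"
      by (elim exE conjE)
    have "openin ?T {x \<in> fst e. snd e x \<in> U}"
      using chart_open_vimage[OF chart[OF e(1)] U(1,3)] .
    moreover have "{x \<in> fst e. snd e x \<in> U} \<subseteq> A"
    proof
      fix x assume "x \<in> {x \<in> fst e. snd e x \<in> U}"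
      then have x: "x \<in> fst e" "snd e x \<in> U" by simp_all
      have "h x = h a"
        using bspec[OF U(4) x(2)] h[OF e(1) x(1)] h[OF e] by simp
      moreover have "x \<in> topspace ?T"
        using x(1) e(1) cover by blast
      ultimately show "x \<in> A"
        using ha by (simp add: A_def)
    qed
    moreover have "a \<in> {x \<in> fst e. snd e x \<in> U}"
      using e U(2) by simp
    ultimately show "\<exists>T. openin ?T T \<and> a \<in> T \<and> T \<subseteq> A"
      by blast
  qed
  moreover have "x0 \<in> A" using x0 by (simp add: A_def)
  ultimately have "A = topspace ?T"
    using conn unfolding connected_space_clopen_in by blast
  with top have "x1 \<in> A" "y1 \<in> A"
    by (simp_all only:)
  then have h0: "h x1 = h x0" "h y1 = h x0"
    unfolding A_def by blast+
  have "g c z = h x1"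
    unfolding x1(2) by (rule h[OF c(1) x1(1), symmetric])
  also have "\<dots> = h y1"
    unfolding h0 ..
  also have "\<dots> = g d w"
    unfolding y1(2) by (rule h[OF d(1) y1(1)])
  finally show ?thesis .
qed

section \<open>Quotient dimensions\<close>

definition indep_mod :: "'a form set \<Rightarrow> 'a form set \<Rightarrow> 'a form set \<Rightarrow> bool" where
  "indep_mod V W S \<longleftrightarrow> finite S \<and> S \<subseteq> V \<and>
     (\<forall>u. (\<Sum>s\<in>S. cscale (u s) s) \<in> W \<longrightarrow> (\<forall>s\<in>S. u s = 0))"

lemma quotient_dim_indep_mod: "quotient_dim V W = (SUP S \<in> {S. indep_mod V W S}. enat (card S))"
  by (simp add: quotient_dim_def indep_mod_def)

lemma card_le_quotient_dim: "indep_mod V W S \<Longrightarrow> enat (card S) \<le> quotient_dim V W"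
  unfolding quotient_dim_indep_mod by (rule SUP_upper) simp

text \<open>A finite supremum in \<open>enat\<close> is a maximum: the empty set makes the family of
  sizes nonempty, and an infinite set of sizes would have supremum \<infinity>.\<close>

lemma quotient_dim_attained:
  assumes "quotient_dim V W = enat r"
  obtains S where "indep_mod V W S" "card S = r"
proof -
  let ?A = "(\<lambda>S. enat (card S)) ` {S. indep_mod V W S}"
  have "indep_mod V W {}" by (simp add: indep_mod_def)
  then have ne: "?A \<noteq> {}" by blast
  moreover have "finite ?A"
  proof (rule ccontr)
    assume "infinite ?A"
    with ne have "Sup ?A = \<infinity>"
      unfolding Sup_enat_def by (simp only: if_False)
    then show False
      using assms unfolding quotient_dim_indep_mod by (simp only: enat.distinct)
  qed
  ultimately have "Sup ?A \<in> ?A"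
    unfolding Sup_enat_def by (simp only: if_True if_False Max_in not_False_eq_True)
  then obtain S where "S \<in> {S. indep_mod V W S}" "Sup ?A = enat (card S)"
    by (rule imageE)
  then show ?thesis
    using assms that[of S] by (simp add: quotient_dim_indep_mod)
qed

text \<open>Linearity is asked on the space of all component functions, which avoids side conditions
  about membership in \<open>forms\<close>.\<close>

definition form_linear :: "('a form \<Rightarrow> 'b form) \<Rightarrow> bool" where
  "form_linear \<sigma> \<longleftrightarrow> (\<forall>\<alpha> \<beta>. \<sigma> (\<alpha> + \<beta>) = \<sigma> \<alpha> + \<sigma> \<beta>) \<and> (\<forall>a \<alpha>. \<sigma> (cscale a \<alpha>) = cscale a (\<sigma> \<alpha>))"

lemma cscale_zero [simp]: "cscale 0 \<alpha> = 0" "cscale a 0 = 0"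
  by (simp_all add: cscale_def fun_eq_iff)

lemma cscale_one [simp]: "cscale 1 \<alpha> = \<alpha>"
  by (simp add: cscale_def)

lemma form_linear_add: "form_linear \<sigma> \<Longrightarrow> \<sigma> (\<alpha> + \<beta>) = \<sigma> \<alpha> + \<sigma> \<beta>"
  by (simp only: form_linear_def)

lemma form_linear_scale: "form_linear \<sigma> \<Longrightarrow> \<sigma> (cscale a \<alpha>) = cscale a (\<sigma> \<alpha>)"
  by (simp only: form_linear_def)

lemma form_linear_zero:
  assumes "form_linear \<sigma>"
  shows "\<sigma> 0 = 0"
  using form_linear_scale[OF assms, of 0] by simp

lemma form_linear_sum:
  assumes "form_linear \<sigma>"
  shows "\<sigma> (\<Sum>s\<in>S. cscale (u s) (F s)) = (\<Sum>s\<in>S. cscale (u s) (\<sigma> (F s)))"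
proof (induction S rule: infinite_finite_induct)
  case (insert x S)
  then show ?case
    by (simp only: sum.insert form_linear_add[OF assms] form_linear_scale[OF assms] not_False_eq_True)
next
  case (infinite A)
  show ?case unfolding sum.infinite[OF infinite] by (rule form_linear_zero[OF assms])
next
  case empty
  show ?case unfolding sum.empty by (rule form_linear_zero[OF assms])
qed

text \<open>The coefficients 1 at \<open>s\<close> and 0 elsewhere would form a nontrivial relation.
  When \<open>W\<close> contains 0, this excludes 0 from independent sets.\<close>

lemma indep_mod_not_coboundary:
  assumes "indep_mod V W S" "s \<in> S"
  shows "s \<notin> W"
proof
  assume "s \<in> W"
  have "(\<Sum>t\<in>S. cscale (if t = s then 1 else 0) t) = s"
  proof -
    have "(\<Sum>t\<in>S. cscale (if t = s then 1 else 0) t) = (\<Sum>t\<in>S. if t = s then s else 0)"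
      by (rule sum.cong) simp_all
    also have "\<dots> = s"
      using assms by (subst sum.delta) (auto simp: indep_mod_def)
    finally show ?thesis .
  qed
  with \<open>s \<in> W\<close> have "(\<Sum>t\<in>S. cscale (if t = s then 1 else 0) t) \<in> W"
    by (simp only:)
  with assms(1) have "\<forall>t\<in>S. (if t = s then 1 else 0 :: complex) = 0"
    unfolding indep_mod_def by (elim conjE allE[of _ "\<lambda>t. if t = s then 1 else 0"] impE)
  then show False
    using assms(2) by auto
qed

text \<open>Applying \<open_sigma>1 is replaced below by its name: \<open>\<sigma>1\<close> kills
  the second family of a relation and returns the first one, which leaves a relation modulo
  \<open>W1\<close>; \<open>\<sigma>2\<close> acts symmetrically. Linearity is asked of these
  retractions, while the independent sets are carried over element by element.\<close>

lemma quotient_dim_add_le: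
  assumes \<sigma>1: "form_linear \<sigma>1" and \<sigma>2: "form_linear \<sigma>2"
    and \<iota>V: "\<And>\<alpha>. \<alpha> \<in> V1 \<Longrightarrow> \<iota>1 \<alpha> \<in> V" "\<And>\<alpha>. \<alpha> \<in> V2 \<Longrightarrow> \<iota>2 \<alpha> \<in> V"
    and \<sigma>W: "\<And>\<alpha>. \<alpha> \<in> W \<Longrightarrow> \<sigma>1 \<alpha> \<in> W1" "\<And>\<alpha>. \<alpha> \<in> W \<Longrightarrow> \<sigma>2 \<alpha> \<in> W2"
    and diag: "\<And>\<alpha>. \<alpha> \<in> V1 \<Longrightarrow> \<sigma>1 (\<iota>1 \<alpha>) = \<alpha>" "\<And>\<alpha>. \<alpha> \<in> V2 \<Longrightarrow> \<sigma>2 (\<iota>2 \<alpha>) = \<alpha>"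
    and cross: "\<And>\<alpha>. \<alpha> \<in> V1 \<Longrightarrow> \<sigma>2 (\<iota>1 \<alpha>) = 0" "\<And>\<alpha>. \<alpha> \<in> V2 \<Longrightarrow> \<sigma>1 (\<iota>2 \<alpha>) = 0"
    and W0: "0 \<in> W1" "0 \<in> W2"
  shows "quotient_dim V1 W1 + quotient_dim V2 W2 \<le> quotient_dim V W"
proof -
  have pair: "enat (card S1 + card S2) \<le> quotient_dim V W"
    if S1: "indep_mod V1 W1 S1" and S2: "indep_mod V2 W2 S2" for S1 S2
  proof -
    have S: "finite S1" "finite S2" "S1 \<subseteq> V1" "S2 \<subseteq> V2"
      using S1 S2 by (auto simp: indep_mod_def)
    have inj1: "inj_on \<iota>1 S1" and inj2: "inj_on \<iota>2 S2"
      using diag S by (metis inj_on_inverseI subsetD)+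
    \<comment> \<open>A common element would be sent by \<open>\<sigma>1\<close> both to
      \<open>s\<close> and to 0, but 0 cannot lie in an independent set.\<close>
    have disj: "\<iota>1 ` S1 \<inter> \<iota>2 ` S2 = {}"
    proof (rule ccontr)
      assume "\<iota>1 ` S1 \<inter> \<iota>2 ` S2 \<noteq> {}"
      then obtain s t where st: "s \<in> S1" "t \<in> S2" "\<iota>1 s = \<iota>2 t" by blast
      then have "\<sigma>1 (\<iota>1 s) = s" "\<sigma>1 (\<iota>1 s) = 0"
        using diag(1)[of s] cross(2)[of t] S by (auto simp only: subset_iff)
      then have "s = 0"
        by (rule trans[OF sym])
      then show False
        using indep_mod_not_coboundary[OF S1 st(1)] W0 by simp
    qed
    let ?S = "\<iota>1 ` S1 \<union> \<iota>2 ` S2"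
    have split: "(\<Sum>s\<in>?S. cscale (u s) s) =
        (\<Sum>s\<in>S1. cscale (u (\<iota>1 s)) (\<iota>1 s)) + (\<Sum>s\<in>S2. cscale (u (\<iota>2 s)) (\<iota>2 s))" for u
      using disj S inj1 inj2 by (simp add: sum.union_disjoint sum.reindex)
    have "indep_mod V W ?S"
      unfolding indep_mod_def
    proof (intro conjI allI impI)
      show "finite ?S" "?S \<subseteq> V"
        using S \<iota>V by auto
      fix u assume u: "(\<Sum>s\<in>?S. cscale (u s) s) \<in> W"
      have "\<sigma>1 (\<Sum>s\<in>?S. cscale (u s) s) = (\<Sum>s\<in>S1. cscale (u (\<iota>1 s)) (\<sigma>1 (\<iota>1 s)))
          + (\<Sum>s\<in>S2. cscale (u (\<iota>2 s)) (\<sigma>1 (\<iota>2 s)))"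
        by (simp only: split form_linear_add[OF \<sigma>1] form_linear_sum[OF \<sigma>1])
      also have "\<dots> = (\<Sum>s\<in>S1. cscale (u (\<iota>1 s)) s)"
        using S by (simp add: subset_iff cross(2) diag(1))
      finally have "(\<Sum>s\<in>S1. cscale (u (\<iota>1 s)) s) \<in> W1"
        using \<sigma>W(1)[OF u] by (simp only:)
      then have u1: "\<forall>s\<in>S1. u (\<iota>1 s) = 0"
        using S1 unfolding indep_mod_def by (elim conjE allE[of _ "\<lambda>s. u (\<iota>1 s)"] impE)
      have "\<sigma>2 (\<Sum>s\<in>?S. cscale (u s) s) = (\<Sum>s\<in>S1. cscale (u (\<iota>1 s)) (\<sigma>2 (\<iota>1 s)))
          + (\<Sum>s\<in>S2. cscale (u (\<iota>2 s)) (\<sigma>2 (\<iota>2 s)))"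
        by (simp only: split form_linear_add[OF \<sigma>2] form_linear_sum[OF \<sigma>2])
      also have "\<dots> = (\<Sum>s\<in>S2. cscale (u (\<iota>2 s)) s)"
        using S by (simp add: subset_iff cross(1) diag(2))
      finally have "(\<Sum>s\<in>S2. cscale (u (\<iota>2 s)) s) \<in> W2"
        using \<sigma>W(2)[OF u] by (simp only:)
      then have u2: "\<forall>s\<in>S2. u (\<iota>2 s) = 0"
        using S2 unfolding indep_mod_def by (elim conjE allE[of _ "\<lambda>s. u (\<iota>2 s)"] impE)
      show "\<forall>s\<in>?S. u s = 0"
        using u1 u2 by blast
    qed
    moreover have "card ?S = card S1 + card S2"
      using disj S inj1 inj2 by (simp add: card_Un_disjoint card_image)
    ultimately show ?thesis
      using card_le_quotient_dim[of V W ?S] by simp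
  qed
  \<comment> \<open>Pairing with the empty family bounds each dimension separately, which settles
    the case of an infinite sum. In the finite case both suprema are attained.\<close>
  have empty: "indep_mod V1 W1 {}" "indep_mod V2 W2 {}"
    by (simp_all add: indep_mod_def)
  have "enat (card S) \<le> quotient_dim V W" if "indep_mod V1 W1 S" for S
    using pair[OF that empty(2)] by simp
  then have le1: "quotient_dim V1 W1 \<le> quotient_dim V W"
    unfolding quotient_dim_indep_mod[of V1] by (intro SUP_least) (simp only: mem_Collect_eq)
  have "enat (card S) \<le> quotient_dim V W" if "indep_mod V2 W2 S" for S
    using pair[OF empty(1) that] by simp
  then have le2: "quotient_dim V2 W2 \<le> quotient_dim V W"
    unfolding quotient_dim_indep_mod[of V2] by (intro SUP_least) (simp only: mem_Collect_eq)
  show ?thesis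
  proof (cases "quotient_dim V1 W1 = \<infinity> \<or> quotient_dim V2 W2 = \<infinity>")
    case True
    then have "\<infinity> \<le> quotient_dim V W"
      using le1 le2 by (elim disjE) (simp_all only:)
    then show ?thesis
      by (rule order_trans[rotated]) simp
  next
    case False
    then obtain r1 r2 where r: "quotient_dim V1 W1 = enat r1" "quotient_dim V2 W2 = enat r2"
      by (meson not_infinity_eq)
    obtain S1 where "indep_mod V1 W1 S1" "card S1 = r1"
      using quotient_dim_attained[OF r(1)] by blast
    moreover obtain S2 where "indep_mod V2 W2 S2" "card S2 = r2"
      using quotient_dim_attained[OF r(2)] by blast
    ultimately show ?thesis
      using pair[of S1 S2] r by simp
  qed
qed

section \<open>Dimension when the space of coboundaries is zero\<close>

lemma vector_space_cscale: "vector_space cscale"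
  by unfold_locales (auto simp: cscale_def fun_eq_iff algebra_simps)

interpretation form_space: vector_space cscale
  by (rule vector_space_cscale)

text \<open>Modulo \<open>{0}\<close> the condition is ordinary linear independence over the complex
  numbers, which opens the way to bases and spans.\<close>

lemma indep_mod_zero: "indep_mod V {0} S \<longleftrightarrow> finite S \<and> S \<subseteq> V \<and> form_space.independent S"
proof (cases "finite S")
  case True
  then show ?thesis
    unfolding indep_mod_def form_space.dependent_finite[OF True] singleton_iff by (metis (lifting))
qed (simp add: indep_mod_def)

text \<open>An independent subset of \<open>V\<close> of maximal size spans \<open>V\<close>, since
  an element outside its span could be adjoined.\<close>

lemma quotient_dim_zero_basis:
  assumes "quotient_dim V {0} = enat r"
  obtains B where "finite B" "card B = r" "V \<subseteq> form_space.span B"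
proof -
  obtain B where B: "indep_mod V {0} B" "card B = r"
    using quotient_dim_attained[OF assms] by blast
  then have fin: "finite B" "B \<subseteq> V" "form_space.independent B"
    by (auto simp: indep_mod_zero)
  have "\<alpha> \<in> form_space.span B" if "\<alpha> \<in> V" for \<alpha>
  proof (rule ccontr)
    assume *: "\<alpha> \<notin> form_space.span B"
    then have "\<alpha> \<notin> B" using form_space.span_base by blast
    have "indep_mod V {0} (insert \<alpha> B)"
      using fin that * by (simp add: indep_mod_zero form_space.independent_insert)
    from card_le_quotient_dim[OF this] have "card (insert \<alpha> B) \<le> r"
      unfolding assms by (simp only: enat_ord_simps)
    then show False
      using B(2) fin(1) \<open>\<alpha> \<notin> B\<close> by simp
  qed
  then show ?thesis
    using that[OF fin(1) B(2)] by blast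
qed

lemma form_linear_span:
  assumes "form_linear \<iota>" "\<alpha> \<in> form_space.span B"
  shows "\<iota> \<alpha> \<in> form_space.span (\<iota> ` B)"
  using assms(2)
proof (induction rule: form_space.span_induct_alt)
  case base
  show ?case unfolding form_linear_zero[OF assms(1)] by (rule form_space.span_zero)
next
  case (step c x y)
  have "\<iota> (cscale c x + y) = cscale c (\<iota> x) + \<iota> y"
    by (simp only: form_linear_add[OF assms(1)] form_linear_scale[OF assms(1)])
  then show ?case
    using step by (simp only: form_space.span_add form_space.span_scale form_space.span_base imageI)
qed

text \<open>The images of two spanning sets span \<open>V\<close>, and an independent set is no
  larger than a finite spanning set. Transporting spans asks for linearity of the inclusions instead
  of the retractions.\<close>

lemma quotient_dim_zero_le_add:
  assumes \<iota>1: "form_linear \<iota>1" and \<iota>2: "form_linear \<iota>2"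
    and \<sigma>V: "\<And>\<alpha>. \<alpha> \<in> V \<Longrightarrow> \<sigma>1 \<alpha> \<in> V1" "\<And>\<alpha>. \<alpha> \<in> V \<Longrightarrow> \<sigma>2 \<alpha> \<in> V2"
    and split: "\<And>\<alpha>. \<alpha> \<in> V \<Longrightarrow> \<alpha> = \<iota>1 (\<sigma>1 \<alpha>) + \<iota>2 (\<sigma>2 \<alpha>)"
  shows "quotient_dim V {0} \<le> quotient_dim V1 {0} + quotient_dim V2 {0}"
proof (cases "quotient_dim V1 {0} = \<infinity> \<or> quotient_dim V2 {0} = \<infinity>")
  case True
  then have "quotient_dim V1 {0} + quotient_dim V2 {0} = \<infinity>"
    by (elim disjE) (simp_all only: plus_enat_simps)
  then show ?thesis
    by (simp only: enat_ord_simps)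
next
  case False
  then obtain r1 r2 where r: "quotient_dim V1 {0} = enat r1" "quotient_dim V2 {0} = enat r2"
    by (meson not_infinity_eq)
  obtain B1 where B1: "finite B1" "card B1 = r1" "V1 \<subseteq> form_space.span B1"
    using quotient_dim_zero_basis[OF r(1)] by blast
  obtain B2 where B2: "finite B2" "card B2 = r2" "V2 \<subseteq> form_space.span B2"
    using quotient_dim_zero_basis[OF r(2)] by blast
  let ?B = "\<iota>1 ` B1 \<union> \<iota>2 ` B2"
  have "V \<subseteq> form_space.span ?B"
  proof
    fix \<alpha> assume \<alpha>: "\<alpha> \<in> V"
    have "\<iota>1 (\<sigma>1 \<alpha>) \<in> form_space.span (\<iota>1 ` B1)" "\<iota>2 (\<sigma>2 \<alpha>) \<in> form_space.span (\<iota>2 ` B2)"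
      using form_linear_span[OF \<iota>1] form_linear_span[OF \<iota>2] \<sigma>V[OF \<alpha>] B1(3) B2(3) by (simp_all only: subset_iff)
    then have "\<iota>1 (\<sigma>1 \<alpha>) \<in> form_space.span ?B" "\<iota>2 (\<sigma>2 \<alpha>) \<in> form_space.span ?B"
      using form_space.span_mono[of "\<iota>1 ` B1" ?B] form_space.span_mono[of "\<iota>2 ` B2" ?B] by auto
    then show "\<alpha> \<in> form_space.span ?B"
      by (subst split[OF \<alpha>]) (rule form_space.span_add)
  qed
  then have "card S \<le> r1 + r2" if "indep_mod V {0} S" for S
  proof -
    have "card S \<le> card ?B"
      using form_space.independent_span_bound[of ?B S] that B1 B2 \<open>V \<subseteq> form_space.span ?B\<close>
      by (auto simp: indep_mod_zero)
    also have "\<dots> \<le> card (\<iota>1 ` B1) + card (\<iota>2 ` B2)"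
      by (rule card_Un_le)
    also have "\<dots> \<le> r1 + r2"
      using card_image_le[OF B1(1), of \<iota>1] card_image_le[OF B2(1), of \<iota>2] B1(2) B2(2) by simp
    finally show ?thesis .
  qed
  then show ?thesis
    unfolding r quotient_dim_indep_mod[of V] by (intro SUP_least) simp
qed

section \<open>Index lists\<close>

lemma length_omit: "a < length xs \<Longrightarrow> length (omit a xs) = length xs - 1"
  by (simp add: omit_def)

lemma set_omit_subset: "set (omit a xs) \<subseteq> set xs"
  unfolding omit_def using set_take_subset[of a xs] set_drop_subset[of "Suc a" xs] by auto

text \<open>In a derivative of a form one index becomes the direction and the others stay with the
  component. This turns the two range conditions into one on the whole list.\<close>

lemma insert_nth_set_omit: "a < length xs \<Longrightarrow> insert (xs ! a) (set (omit a xs)) = set xs"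
  using arg_cong[OF id_take_nth_drop[of a xs], of set] by (simp add: omit_def)

lemma omit_map: "omit a (map f xs) = map f (omit a xs)"
  by (simp add: omit_def take_map drop_map)

lemma length_swap_at [simp]: "length (swap_at a b xs) = length xs"
  by (simp add: swap_at_def)

lemma set_swap_at: "a < length xs \<Longrightarrow> b < length xs \<Longrightarrow> set (swap_at a b xs) = set xs"
  by (simp add: swap_at_def)

lemma map_swap_at:
  "a < length xs \<Longrightarrow> b < length xs \<Longrightarrow> map f (swap_at a b xs) = swap_at a b (map f xs)"
  by (simp add: swap_at_def map_update)

lemma finite_indices: "finite (indices n l)"
  unfolding indices_def using finite_lists_length_eq[of "{..<n}" l] by (simp add: conj_commute)

text \<open>For use in the transformation law: terms whose indices leave the block of one factor
  vanish, and the remaining lists are those of the factor shifted by \<open>m\<close>.\<close>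

lemma sum_indices_shift:
  fixes G :: "nat list \<Rightarrow> complex"
  assumes "m + n \<le> N" "\<And>ks. ks \<in> indices N p \<Longrightarrow> \<not> set ks \<subseteq> {m..<m + n} \<Longrightarrow> G ks = 0"
  shows "(\<Sum>ks\<in>indices N p. G ks) = (\<Sum>ks\<in>indices n p. G (map ((+) m) ks))"
proof -
  have "inj_on (map ((+) m)) (indices n p)"
    by (rule inj_onI) (simp add: inj_map_eq_map)
  moreover have "map ((+) m) ` indices n p = {ks \<in> indices N p. set ks \<subseteq> {m..<m + n}}"
  proof (intro equalityI subsetI)
    fix ks assume "ks \<in> map ((+) m) ` indices n p"
    then show "ks \<in> {ks \<in> indices N p. set ks \<subseteq> {m..<m + n}}"
      using assms(1) by (fastforce simp: indices_def)
  next
    fix ks assume ks: "ks \<in> {ks \<in> indices N p. set ks \<subseteq> {m..<m + n}}"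
    have "ks = map ((+) m) (map (\<lambda>i. i - m) ks)"
      unfolding map_map by (rule map_idI[symmetric]) (use ks in auto)
    moreover have "map (\<lambda>i. i - m) ks \<in> indices n p"
      using ks by (fastforce simp: indices_def)
    ultimately show "ks \<in> map ((+) m) ` indices n p"
      by (rule image_eqI)
  qed
  ultimately have "(\<Sum>ks\<in>indices n p. G (map ((+) m) ks)) = (\<Sum>ks | ks \<in> indices N p \<and> set ks \<subseteq> {m..<m + n}. G ks)"
    using sum.reindex[of "map ((+) m)" "indices n p" G] by (simp add: comp_def)
  also have "\<dots> = (\<Sum>ks\<in>indices N p. G ks)"
    by (rule sum.mono_neutral_left) (use assms(2) finite_indices in auto)
  finally show ?thesis ..
qed

text \<open>A product of Kronecker deltas over all positions is the delta of the lists. So the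
  transformation law for an identity Jacobian has a single term.\<close>

lemma sum_indices_delta:
  fixes G :: "nat list \<Rightarrow> complex"
  assumes "ps \<in> indices n p"
  shows "(\<Sum>ks\<in>indices n p. (\<Prod>a<p. if ks ! a = ps ! a then 1 else 0) * G ks) = G ps"
proof -
  have "(\<Prod>a<p. if ks ! a = ps ! a then 1 else 0) * G ks = (if ks = ps then G ps else 0)"
    if ks: "ks \<in> indices n p" for ks
  proof (cases "ks = ps")
    case False
    then obtain a where "a < p" "ks ! a \<noteq> ps ! a"
      using ks assms by (auto simp: indices_def list_eq_iff_nth_eq)
    then have "(\<Prod>a<p. if ks ! a = ps ! a then 1 else 0 :: complex) = 0"
      by (intro prod_zero) auto
    then show ?thesis using False by simp
  qed simp
  then have "(\<Sum>ks\<in>indices n p. (\<Prod>a<p. if ks ! a = ps ! a then 1 else 0) * G ks) =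
      (\<Sum>ks\<in>indices n p. if ks = ps then G ps else 0)"
    by (rule sum.cong[OF refl])
  also have "\<dots> = G ps"
    using finite_indices assms by (simp add: sum.delta)
  finally show ?thesis .
qed

section \<open>Forms\<close>

lemma formsD:
  assumes "\<omega> \<in> forms M p q"
  shows "\<not> (meaningful M c z ps qs \<and> int (length ps) = p \<and> int (length qs) = q) \<Longrightarrow> \<omega> c z ps qs = 0"
    and "c \<in> atlas M \<Longrightarrow> smooth_on (mdim M) (chart_image c) (\<lambda>z. \<omega> c z ps qs)"
    and "alternating \<omega>" "compatible M \<omega>"
  using assms unfolding forms_def by blast+

lemma alternatingD:
  assumes "alternating \<omega>" "a < b"
  shows "b < length ps \<Longrightarrow> \<omega> c z (swap_at a b ps) qs = - \<omega> c z ps qs"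
    and "b < length qs \<Longrightarrow> \<omega> c z ps (swap_at a b qs) = - \<omega> c z ps qs"
  using assms unfolding alternating_def by blast+

lemma compatibleD:
  assumes "compatible M \<omega>" "c \<in> atlas M" "c' \<in> atlas M" "z \<in> overlap c c'"
    and "set ps \<subseteq> {..<mdim M}" "set qs \<subseteq> {..<mdim M}"
  shows "\<omega> c z ps qs = (\<Sum>ks\<in>indices (mdim M) (length ps). \<Sum>ls\<in>indices (mdim M) (length qs).
            (\<Prod>a<length ps. dz (ps ! a) (\<lambda>w. chart_change c c' w (ks ! a)) z) *
            (\<Prod>b<length qs. cnj (dz (qs ! b) (\<lambda>w. chart_change c c' w (ls ! b)) z)) *
            \<omega> c' (chart_change c c' z) ks ls)"
  using assms unfolding compatible_def by blast

lemma zero_in_forms: "0 \<in> forms M p q"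
  by (auto simp: forms_def alternating_def compatible_def smooth_on_const)

lemma forms_negative:
  assumes "p < 0 \<or> q < 0"
  shows "forms M p q = {0}"
proof -
  have "\<omega> = 0" if "\<omega> \<in> forms M p q" for \<omega>
    using formsD(1)[OF that] assms by (intro ext) fastforce
  then show ?thesis
    using zero_in_forms by blast
qed

lemma del_zero: "del M 0 = 0"
  by (intro ext) (simp add: del_def)

lemma delbar_zero: "delbar M 0 = 0"
  by (intro ext) (simp add: delbar_def)

text \<open>The two parts of \<open>ext_d\<close> cannot cancel: \<open>del\<close> is supported on
  holomorphic lists of length \<open>p + 1\<close>, and \<open>delbar\<close> on those of length
  \<open>p\<close>.\<close>

lemma del_eq_zero_if_ext_d_eq_zero:
  assumes \<omega>: "\<omega> \<in> forms M p q" and d: "ext_d M \<omega> = 0"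
  shows "del M \<omega> = 0"
proof (intro ext)
  fix c z ps qs
  show "del M \<omega> c z ps qs = 0 c z ps qs"
  proof (cases "int (length ps) = p + 1")
    case True
    then have "\<omega> c w ps (omit b qs) = 0" for b w
      using formsD(1)[OF \<omega>] by auto
    then have "delbar M \<omega> c z ps qs = 0"
      by (simp add: delbar_def)
    then show ?thesis
      using fun_cong[OF fun_cong[OF fun_cong[OF fun_cong[OF d]]], of c z ps qs] by (simp add: ext_d_def)
  next
    case False
    then have "\<omega> c w (omit a ps) qs = 0" if "a < length ps" for a w
      using formsD(1)[OF \<omega>] that by (auto simp: length_omit)
    then show ?thesis
      by (simp add: del_def)
  qed
qed

text \<open>The change of coordinates is the identity, so its Jacobian is the Kronecker delta. This
  makes a choice between charts that agree on their common domain harmless.\<close>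

lemma form_same_chart:
  assumes M: "complex_manifold M" and \<omega>: "\<omega> \<in> forms M p q" and c: "c \<in> atlas M" "d \<in> atlas M"
    and eq: "fst c = fst d" "\<And>x. x \<in> fst c \<Longrightarrow> snd c x = snd d x" and z: "z \<in> chart_image c"
  shows "\<omega> c z ps qs = \<omega> d z ps qs"
proof (cases "set ps \<subseteq> {..<mdim M} \<and> set qs \<subseteq> {..<mdim M}")
  case True
  have ov: "overlap c d = chart_image c"
    using eq by (simp add: overlap_def chart_image_def)
  have change: "chart_change c d w = w" if w: "w \<in> chart_image c" for w
  proof -
    obtain x where "x \<in> fst c" "w = snd c x"
      using w by (auto simp: chart_image_def)
    then show ?thesis
      using chart_change_apply[OF atlas_is_chart[OF M c(1)]] eq by simp
  qed
  have dz: "dz i (\<lambda>w. chart_change c d w j) z = (if j = i then 1 else 0)" if "i < mdim M" for i j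
    using dz_cong[OF chart_image_open[OF M c(1)] z that, of "\<lambda>w. chart_change c d w j" "\<lambda>w. w j"] change
    by (simp add: dz_coordinate)
  have ind: "ps \<in> indices (mdim M) (length ps)" "qs \<in> indices (mdim M) (length qs)"
    using True by (auto simp: indices_def)
  have "(\<Prod>a<length ps. dz (ps ! a) (\<lambda>w. chart_change c d w (ks ! a)) z) =
      (\<Prod>a<length ps. if ks ! a = ps ! a then 1 else 0)" for ks
    using True by (intro prod.cong refl dz) (auto simp: subset_iff)
  moreover have "(\<Prod>b<length qs. cnj (dz (qs ! b) (\<lambda>w. chart_change c d w (ls ! b)) z)) =
      (\<Prod>b<length qs. if ls ! b = qs ! b then 1 else 0)" for ls
    by (intro prod.cong refl, subst dz) (use True in \<open>auto simp: subset_iff\<close>)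
  ultimately have "\<omega> c z ps qs = (\<Sum>ks\<in>indices (mdim M) (length ps). \<Sum>ls\<in>indices (mdim M) (length qs).
            (\<Prod>a<length ps. if ks ! a = ps ! a then 1 else 0) *
            (\<Prod>b<length qs. if ls ! b = qs ! b then 1 else 0) * \<omega> d z ks ls)"
    using compatibleD[OF formsD(4)[OF \<omega>] c, of z ps qs] ov z True change[OF z] by simp
  also have "\<dots> = (\<Sum>ks\<in>indices (mdim M) (length ps). (\<Prod>a<length ps. if ks ! a = ps ! a then 1 else 0) *
      (\<Sum>ls\<in>indices (mdim M) (length qs). (\<Prod>b<length qs. if ls ! b = qs ! b then 1 else 0) * \<omega> d z ks ls))"
    by (simp add: sum_distrib_left mult.assoc)
  also have "\<dots> = \<omega> d z ps qs"
    unfolding sum_indices_delta[OF ind(2)] sum_indices_delta[OF ind(1)] ..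
  finally show ?thesis .
next
  case False
  then have "\<not> meaningful M e z ps qs" for e
    by (auto simp: meaningful_def)
  then show ?thesis
    using formsD(1)[OF \<omega>] by simp
qed

section \<open>Products\<close>

text \<open>Inverse to the pair of projections to the blocks. Two separate offsets allow either
  factor to come first.\<close>

definition join :: "nat \<Rightarrow> nat \<Rightarrow> nat \<Rightarrow> nat \<Rightarrow> (nat \<Rightarrow> complex) \<Rightarrow> (nat \<Rightarrow> complex) \<Rightarrow> nat \<Rightarrow> complex" where
  "join m n k l z w = (\<lambda>i. if m \<le> i \<and> i < m + n then z (i - m) else if k \<le> i \<and> i < k + l then w (i - k) else 0)"

lemma coords_nth: "j \<in> {m..<m + n} \<Longrightarrow> coords m n z (j - m) = z j"
  by (auto simp: coords_def)

lemma coord_subst_coords: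
  "coord_subst N n (\<lambda>j. if m \<le> j \<and> j < m + n then Some (j - m) else None) (coords m n)"
proof -
  have "continuous_on UNIV (\<lambda>z. coords m n z i)" for i
    by (cases "i < n") (simp_all add: coords_def continuous_on_product_coordinates)
  then have "continuous_on UNIV (coords m n)"
    by (rule continuous_on_coordinatewise_then_product)
  then show ?thesis
    by (auto simp: coord_subst_def coords_def fun_eq_iff)
qed

lemma coord_subst_join_left:
  assumes "m + n \<le> N"
  shows "coord_subst n N (\<lambda>j. Some (m + j)) (\<lambda>z. join m n k l z w)"
proof -
  have "continuous_on UNIV (\<lambda>z. join m n k l z w i)" for i
    by (cases "m \<le> i \<and> i < m + n") (auto simp: join_def continuous_on_product_coordinates)
  then have "continuous_on UNIV (\<lambda>z. join m n k l z w)"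
    by (rule continuous_on_coordinatewise_then_product)
  then show ?thesis
    using assms by (auto simp: coord_subst_def join_def fun_eq_iff)
qed

text \<open>The first block takes precedence in \<open>join\<close>, so the blocks must be disjoint
  for all coordinates of \<open>w\<close> to appear.\<close>

lemma coord_subst_join_right:
  assumes "k + l \<le> N" "{m..<m + n} \<inter> {k..<k + l} = {}"
  shows "coord_subst l N (\<lambda>j. Some (k + j)) (\<lambda>w. join m n k l z w)"
proof -
  have disj: "\<not> (m \<le> k + j \<and> k + j < m + n)" if "j < l" for j
    using assms(2) that by auto
  have "continuous_on UNIV (\<lambda>w. join m n k l z w i)" for i
    by (cases "m \<le> i \<and> i < m + n"; cases "k \<le> i \<and> i < k + l") (auto simp: join_def continuous_on_product_coordinates)
  then have "continuous_on UNIV (\<lambda>w. join m n k l z w)"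
    by (rule continuous_on_coordinatewise_then_product)
  moreover have "join m n k l z (w(j := v)) = (join m n k l z w)(k + j := v)" if "j < l" for w v j
    using disj[OF that] that by (auto simp: join_def fun_eq_iff)
  ultimately show ?thesis
    using assms(1) disj by (auto simp: coord_subst_def join_def)
qed

text \<open>
  Pullback along the projection to a factor that has the coordinates with indices from m to
  m + n - 1. The chart \<open>rep C\<close> of the factor is one of those which have \<open>C\<close> as a product with another
  chart.
\<close>

definition pull_form :: "'p manifold \<Rightarrow> ('p chart \<Rightarrow> 'm chart) \<Rightarrow> nat \<Rightarrow> nat \<Rightarrow> 'm form \<Rightarrow> 'p form" where
  "pull_form P rep m n \<omega> C z ps qs =
     (if meaningful P C z ps qs \<and> set ps \<subseteq> {m..<m + n} \<and> set qs \<subseteq> {m..<m + n}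
      then \<omega> (rep C) (coords m n z) (map (\<lambda>i. i - m) ps) (map (\<lambda>i. i - m) qs) else 0)"

text \<open>Restriction to a slice that is given in coordinates by the embedding \<open>\<phi>\<close>.\<close>

definition slice_form :: "'m manifold \<Rightarrow> ('m chart \<Rightarrow> 'p chart) \<Rightarrow> ((nat \<Rightarrow> complex) \<Rightarrow> nat \<Rightarrow> complex) \<Rightarrow>
    nat \<Rightarrow> 'p form \<Rightarrow> 'm form" where
  "slice_form M E \<phi> m \<omega> c z ps qs =
     (if meaningful M c z ps qs then \<omega> (E c) (\<phi> z) (map ((+) m) ps) (map ((+) m) qs) else 0)"

lemma form_linear_pull: "form_linear (pull_form P rep m n)"
  by (simp add: form_linear_def pull_form_def cscale_def fun_eq_iff)

lemma form_linear_slice: "form_linear (slice_form M E \<phi> m)"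
  by (simp add: form_linear_def slice_form_def cscale_def fun_eq_iff)

text \<open>Indices on the slice are shifted into a block that is disjoint from the one supporting
  the pullback. Only empty index lists escape this, and they belong to bidegree (0,0), where
  pulled-back functions restrict to constants.\<close>

lemma slice_pull_cross:
  assumes disj: "{m..<m + mdim M} \<inter> {k..<k + l} = {}" and \<omega>: "\<omega> \<in> forms L p q" and pq: "(p, q) \<noteq> (0, 0)"
  shows "slice_form M E \<phi> m (pull_form P rep k l \<omega>) = 0"
proof -
  have "slice_form M E \<phi> m (pull_form P rep k l \<omega>) c z ps qs = 0" for c z ps qs
  proof (cases "ps = [] \<and> qs = []")
    case True
    then show ?thesis
      using formsD(1)[OF \<omega>, of _ _ "[]" "[]"] pq by (auto simp: slice_form_def pull_form_def)
  next
    case False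
    have "\<not> (set (map ((+) m) ps) \<subseteq> {k..<k + l} \<and> set (map ((+) m) qs) \<subseteq> {k..<k + l})"
      if "meaningful M c z ps qs"
    proof
      assume *: "set (map ((+) m) ps) \<subseteq> {k..<k + l} \<and> set (map ((+) m) qs) \<subseteq> {k..<k + l}"
      obtain i where "i \<in> set ps \<union> set qs"
        using False by (cases ps; cases qs) auto
      then have "i < mdim M" "m + i \<in> {k..<k + l}"
        using * that by (auto simp: meaningful_def)
      then show False
        using disj by (auto simp: disjoint_iff)
    qed
    then have "pull_form P rep k l \<omega> (E c) (\<phi> z) (map ((+) m) ps) (map ((+) m) qs) = 0"
      if "meaningful M c z ps qs"
      using that unfolding pull_form_def by (intro if_not_P) blast
    then show ?thesis
      by (simp add: slice_form_def)
  qed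
  then show ?thesis
    by (intro ext) simp
qed

text \<open>
  Symmetric in the two factors of \<open>P\<close>, so that it applies to each of them in the role of \<open>M\<close>.
\<close>

locale product_factor =
  fixes P :: "'p manifold" and M :: "'m manifold" and L :: "'l manifold"
    and pc :: "'m chart \<Rightarrow> 'l chart \<Rightarrow> 'p chart" and m k :: nat
  assumes M: "complex_manifold M" and L: "complex_manifold L"
    and dim: "mdim P = mdim M + mdim L"
    and offsets: "m = 0 \<and> k = mdim M \<or> m = mdim L \<and> k = 0"
    and atlas: "atlas P = {pc c c' | c c'. c \<in> atlas M \<and> c' \<in> atlas L}"
    and overlap: "\<And>c c' d d'. c \<in> atlas M \<Longrightarrow> c' \<in> atlas L \<Longrightarrow> d \<in> atlas M \<Longrightarrow> d' \<in> atlas L \<Longrightarrow>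
      overlap (pc c c') (pc d d') =
        {z \<in> cspace (mdim P). coords m (mdim M) z \<in> overlap c d \<and> coords k (mdim L) z \<in> overlap c' d'}"
    and change: "\<And>c c' d d' z. c \<in> atlas M \<Longrightarrow> c' \<in> atlas L \<Longrightarrow> d \<in> atlas M \<Longrightarrow> d' \<in> atlas L \<Longrightarrow>
      z \<in> overlap (pc c c') (pc d d') \<Longrightarrow>
      chart_change (pc c c') (pc d d') z \<in> cspace (mdim P) \<and>
      coords m (mdim M) (chart_change (pc c c') (pc d d') z) = chart_change c d (coords m (mdim M) z) \<and>
      coords k (mdim L) (chart_change (pc c c') (pc d d') z) = chart_change c' d' (coords k (mdim L) z)"
    and pc_eqD: "\<And>c c' d d'. c \<in> atlas M \<Longrightarrow> c' \<in> atlas L \<Longrightarrow> d \<in> atlas M \<Longrightarrow> d' \<in> atlas L \<Longrightarrow>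
      pc c c' = pc d d' \<Longrightarrow> chart_image (pc c c') \<noteq> {} \<Longrightarrow>
      fst c = fst d \<and> (\<forall>x\<in>fst c. snd c x = snd d x)"
begin

abbreviation "n \<equiv> mdim M"
abbreviation "l \<equiv> mdim L"
abbreviation "prM \<equiv> coords m n"
abbreviation "prL \<equiv> coords k l"
abbreviation "glue \<equiv> join m n k l"

definition rep :: "'p chart \<Rightarrow> 'm chart" where
  "rep C = (SOME c. c \<in> atlas M \<and> (\<exists>c'\<in>atlas L. C = pc c c'))"

definition pull :: "'m form \<Rightarrow> 'p form" where
  "pull = pull_form P rep m n"

lemma rep:
  assumes "C \<in> atlas P"
  obtains c' where "rep C \<in> atlas M" "c' \<in> atlas L" "C = pc (rep C) c'"
proof -
  have "\<exists>c. c \<in> atlas M \<and> (\<exists>c'\<in>atlas L. C = pc c c')"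
    using assms atlas by blast
  from someI_ex[OF this] have "rep C \<in> atlas M \<and> (\<exists>c'\<in>atlas L. C = pc (rep C) c')"
    unfolding rep_def .
  then show ?thesis using that by blast
qed

lemma pc_atlas: "c \<in> atlas M \<Longrightarrow> c' \<in> atlas L \<Longrightarrow> pc c c' \<in> atlas P"
  using atlas by blast

lemma ranges:
  "m + n \<le> mdim P" "k + l \<le> mdim P" "{m..<m + n} \<inter> {k..<k + l} = {}"
  "i < mdim P \<Longrightarrow> i \<in> {m..<m + n} \<or> i \<in> {k..<k + l}"
  using dim offsets by auto

lemma prM_glue: "z \<in> cspace n \<Longrightarrow> prM (glue z w) = z"
  by (auto simp: coords_def join_def cspace_def fun_eq_iff)

lemma prL_glue: "w \<in> cspace l \<Longrightarrow> prL (glue z w) = w"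
  using offsets by (auto simp: coords_def join_def cspace_def fun_eq_iff)

lemma glue_cspace: "glue z w \<in> cspace (mdim P)"
  using dim offsets by (auto simp: join_def cspace_def)

lemma glue_pr: "z \<in> cspace (mdim P) \<Longrightarrow> glue (prM z) (prL z) = z"
  using dim offsets by (auto simp: join_def coords_def cspace_def fun_eq_iff)

section \<open>Chart images, overlaps and Jacobians of product charts\<close>

lemma chart_image_pc:
  assumes "c \<in> atlas M" "c' \<in> atlas L"
  shows "chart_image (pc c c') = {z \<in> cspace (mdim P). prM z \<in> chart_image c \<and> prL z \<in> chart_image c'}"
  using overlap[OF assms assms] by (simp add: overlap_self)

lemma glue_chart_image:
  assumes "c \<in> atlas M" "c' \<in> atlas L" "z \<in> chart_image c" "w \<in> chart_image c'"
  shows "glue z w \<in> chart_image (pc c c')" "prM (glue z w) = z" "prL (glue z w) = w"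
proof -
  show *: "prM (glue z w) = z" "prL (glue z w) = w"
    using prM_glue prL_glue chart_image_cspace[OF M] chart_image_cspace[OF L] assms by blast+
  show "glue z w \<in> chart_image (pc c c')"
    using assms(3,4) glue_cspace by (simp add: chart_image_pc[OF assms(1,2)] *)
qed

lemma glue_overlap:
  assumes "c \<in> atlas M" "c' \<in> atlas L" "d \<in> atlas M" "d' \<in> atlas L"
    and "z \<in> overlap c d" "w \<in> overlap c' d'"
  shows "glue z w \<in> overlap (pc c c') (pc d d')"
    "chart_change (pc c c') (pc d d') (glue z w) = glue (chart_change c d z) (chart_change c' d' w)"
proof -
  have "z \<in> chart_image c" "w \<in> chart_image c'"
    using assms(5,6) overlap_subset by blast+
  note g = glue_chart_image[OF assms(1,2) this]
  show *: "glue z w \<in> overlap (pc c c') (pc d d')"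
    using assms(5,6) glue_cspace by (simp add: overlap[OF assms(1-4)] g(2,3))
  show "chart_change (pc c c') (pc d d') (glue z w) = glue (chart_change c d z) (chart_change c' d' w)"
    using change[OF assms(1-4) *] glue_pr[of "chart_change (pc c c') (pc d d') (glue z w)"] g(2,3) by simp
qed

lemma pr_open:
  assumes "openin (top_of_set (cspace n)) U" "openin (top_of_set (cspace l)) U'"
  shows "openin (top_of_set (cspace (mdim P))) {z \<in> cspace (mdim P). prM z \<in> U \<and> prL z \<in> U'}"
proof -
  obtain V V' where V: "open V" "U = cspace n \<inter> V" "open V'" "U' = cspace l \<inter> V'"
    using assms by (auto simp: openin_open)
  have "continuous_on UNIV prM" "continuous_on UNIV prL"
    using coord_subst_coords by (auto simp: coord_subst_def)
  then have "open (prM -` V \<inter> prL -` V')"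
    using V by (intro open_Int open_vimage)
  moreover have "{z \<in> cspace (mdim P). prM z \<in> U \<and> prL z \<in> U'} = cspace (mdim P) \<inter> (prM -` V \<inter> prL -` V')"
    using V coords_cspace by auto
  ultimately show ?thesis
    by (auto simp: openin_open)
qed

text \<open>The charts of \<open>P\<close> are described through those of \<open>M\<close> and
  \<open>L\<close>, so openness of an overlap comes from that of its two projections.\<close>

lemma overlap_open_P:
  assumes "C \<in> atlas P" "D \<in> atlas P"
  shows "openin (top_of_set (cspace (mdim P))) (overlap C D)"
proof -
  obtain c c' where c: "c \<in> atlas M" "c' \<in> atlas L" "C = pc c c'"
    using assms(1) atlas by blast
  obtain d d' where d: "d \<in> atlas M" "d' \<in> atlas L" "D = pc d d'"
    using assms(2) atlas by blast
  show ?thesis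
    unfolding c(3) d(3) overlap[OF c(1,2) d(1,2)]
    by (intro pr_open overlap_open M L c d)
qed

lemma chart_image_open_P:
  "C \<in> atlas P \<Longrightarrow> openin (top_of_set (cspace (mdim P))) (chart_image C)"
  using overlap_open_P[of C C] by (simp add: overlap_self)

lemma chart_change_mem_P:
  assumes "c \<in> atlas M" "c' \<in> atlas L" "d \<in> atlas M" "d' \<in> atlas L" "z \<in> overlap (pc c c') (pc d d')"
  shows "chart_change (pc c c') (pc d d') z \<in> chart_image (pc d d')"
proof -
  have "prM z \<in> overlap c d" "prL z \<in> overlap c' d'"
    using assms(5) overlap[OF assms(1-4)] by auto
  then show ?thesis
    using change[OF assms] chart_change_mem[OF M assms(1)] chart_change_mem[OF L assms(2)]
    by (simp add: chart_image_pc[OF assms(3,4)])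
qed

lemma dz_pr:
  assumes "i < mdim P"
  shows "dz i (\<lambda>z. F (prM z)) z = (if i \<in> {m..<m + n} then dz (i - m) F (prM z) else 0)"
    and "dzbar i (\<lambda>z. F (prM z)) z = (if i \<in> {m..<m + n} then dzbar (i - m) F (prM z) else 0)"
    and "dz i (\<lambda>z. F (prL z)) z = (if i \<in> {k..<k + l} then dz (i - k) F (prL z) else 0)"
  using dz_subst[OF coord_subst_coords[of "mdim P" n m] assms]
    dzbar_subst[OF coord_subst_coords[of "mdim P" n m] assms]
    dz_subst[OF coord_subst_coords[of "mdim P" l k] assms] by auto

lemma dz_glue:
  "j < n \<Longrightarrow> dz j (\<lambda>z. F (glue z w)) z = dz (m + j) F (glue z w)"
  "j < n \<Longrightarrow> dzbar j (\<lambda>z. F (glue z w)) z = dzbar (m + j) F (glue z w)"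
  "j < l \<Longrightarrow> dz j (\<lambda>w. F (glue z w)) w = dz (k + j) F (glue z w)"
  using dz_subst[OF coord_subst_join_left[OF ranges(1)]] dzbar_subst[OF coord_subst_join_left[OF ranges(1)]]
    dz_subst[OF coord_subst_join_right[OF ranges(2,3)]] by auto

text \<open>The Jacobian matrix of a change of product charts is block diagonal.\<close>

lemma dz_change:
  assumes "c \<in> atlas M" "c' \<in> atlas L" "d \<in> atlas M" "d' \<in> atlas L" "z \<in> overlap (pc c c') (pc d d')"
    and "i < mdim P"
  shows "j \<in> {m..<m + n} \<Longrightarrow> dz i (\<lambda>w. chart_change (pc c c') (pc d d') w j) z =
      (if i \<in> {m..<m + n} then dz (i - m) (\<lambda>w. chart_change c d w (j - m)) (prM z) else 0)"
    and "j \<in> {k..<k + l} \<Longrightarrow> dz i (\<lambda>w. chart_change (pc c c') (pc d d') w j) z =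
      (if i \<in> {k..<k + l} then dz (i - k) (\<lambda>w. chart_change c' d' w (j - k)) (prL z) else 0)"
proof -
  note op = overlap_open_P[OF pc_atlas[OF assms(1,2)] pc_atlas[OF assms(3,4)]]
  {
    assume j: "j \<in> {m..<m + n}"
    have "chart_change (pc c c') (pc d d') w j = chart_change c d (prM w) (j - m)"
      if "w \<in> overlap (pc c c') (pc d d')" for w
      using change[OF assms(1-4) that] coords_nth[OF j] by metis
    then have "dz i (\<lambda>w. chart_change (pc c c') (pc d d') w j) z = dz i (\<lambda>w. chart_change c d (prM w) (j - m)) z"
      by (rule dz_cong[OF op assms(5,6)])
    then show "dz i (\<lambda>w. chart_change (pc c c') (pc d d') w j) z =
      (if i \<in> {m..<m + n} then dz (i - m) (\<lambda>w. chart_change c d w (j - m)) (prM z) else 0)"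
      using dz_pr(1)[OF assms(6), of "\<lambda>w. chart_change c d w (j - m)" z] by (rule trans)
  }
  {
    assume j: "j \<in> {k..<k + l}"
    have "chart_change (pc c c') (pc d d') w j = chart_change c' d' (prL w) (j - k)"
      if "w \<in> overlap (pc c c') (pc d d')" for w
      using change[OF assms(1-4) that] coords_nth[OF j] by metis
    then have "dz i (\<lambda>w. chart_change (pc c c') (pc d d') w j) z = dz i (\<lambda>w. chart_change c' d' (prL w) (j - k)) z"
      by (rule dz_cong[OF op assms(5,6)])
    then show "dz i (\<lambda>w. chart_change (pc c c') (pc d d') w j) z =
      (if i \<in> {k..<k + l} then dz (i - k) (\<lambda>w. chart_change c' d' w (j - k)) (prL z) else 0)"
      using dz_pr(3)[OF assms(6), of "\<lambda>w. chart_change c' d' w (j - k)" z] by (rule trans)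
  }
qed

text \<open>The chosen chart and \<open>c\<close> are factors of the same nonempty product chart,
  hence agree on their domain, and a form cannot distinguish them there.\<close>

lemma rep_same_chart:
  assumes \<omega>: "\<omega> \<in> forms M p q" and c: "c \<in> atlas M" "c' \<in> atlas L"
    and z: "z \<in> chart_image c" and ne: "chart_image (pc c c') \<noteq> {}"
  shows "\<omega> (rep (pc c c')) z ps qs = \<omega> c z ps qs"
proof -
  obtain d' where d: "rep (pc c c') \<in> atlas M" "d' \<in> atlas L" "pc c c' = pc (rep (pc c c')) d'"
    by (rule rep[OF pc_atlas[OF c]])
  from pc_eqD[OF c d(1,2,3) ne] show ?thesis
    using form_same_chart[OF M \<omega> c(1) d(1) _ _ z] by simp
qed

section \<open>Pullback of forms along a projection\<close>

lemma map_diff_range: "set ps \<subseteq> {m..<m + n} \<Longrightarrow> set (map (\<lambda>i. i - m) ps) \<subseteq> {..<n}"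
  by fastforce

lemma map_add_range: "set ps \<subseteq> {..<n} \<Longrightarrow> set (map ((+) m) ps) \<subseteq> {m..<m + n}"
  by fastforce

lemma map_add_range_P: "set ps \<subseteq> {..<n} \<Longrightarrow> set (map ((+) m) ps) \<subseteq> {..<mdim P}"
  using ranges(1) by fastforce

lemma map_diff_add: "map (\<lambda>i. i - m) (map ((+) m) ps) = ps"
  by (simp add: comp_def)

text \<open>Jacobian entries linking the two factors vanish. So the transformation law of the
  pullback involves only index lists in the block of \<open>M\<close>, where it is the law of
  \<omega>.\<close>

lemma pull_form_in_forms:
  assumes \<omega>: "\<omega> \<in> forms M p q"
  shows "pull \<omega> \<in> forms P p q"
  unfolding forms_def
proof (intro CollectI conjI allI impI ballI)
  fix C z ps qs
  assume "\<not> (meaningful P C z ps qs \<and> int (length ps) = p \<and> int (length qs) = q)"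
  then show "pull \<omega> C z ps qs = 0"
    using formsD(1)[OF \<omega>] by (auto simp: pull_def pull_form_def)
next
  fix C ps qs assume C: "C \<in> atlas P"
  obtain c' where c: "rep C \<in> atlas M" "c' \<in> atlas L" "C = pc (rep C) c'"
    by (rule rep[OF C])
  have pr: "prM z \<in> chart_image (rep C)" if "z \<in> chart_image C" for z
    using that chart_image_pc[OF c(1,2)] c(3) by simp
  show "smooth_on (mdim P) (chart_image C) (\<lambda>z. pull \<omega> C z ps qs)"
  proof (cases "set ps \<subseteq> {m..<m + n} \<and> set qs \<subseteq> {m..<m + n}")
    case True
    then have "set ps \<subseteq> {..<mdim P}" "set qs \<subseteq> {..<mdim P}"
      using ranges(1) by auto
    then have "\<omega> (rep C) (prM z) (map (\<lambda>i. i - m) ps) (map (\<lambda>i. i - m) qs) = pull \<omega> C z ps qs"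
      if "z \<in> chart_image C" for z
      using True C that by (simp add: pull_def pull_form_def meaningful_def)
    moreover have "smooth_on (mdim P) (chart_image C)
        (\<lambda>z. \<omega> (rep C) (prM z) (map (\<lambda>i. i - m) ps) (map (\<lambda>i. i - m) qs))"
      by (rule smooth_on_subst[OF coord_subst_coords _ formsD(2)[OF \<omega> c(1)]]) (rule pr)
    ultimately show ?thesis
      by (rule smooth_on_cong[OF chart_image_open_P[OF C]])
  next
    case False
    then have "(\<lambda>z. pull \<omega> C z ps qs) = (\<lambda>z. 0)"
      unfolding pull_def pull_form_def by (intro ext if_not_P) blast
    then show ?thesis
      by (simp only: smooth_on_const)
  qed
next
  show "alternating (pull \<omega>)"
    unfolding alternating_def
  proof (intro allI impI conjI)
    fix C z and ps qs :: "nat list" and a b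
    assume ab: "a < b \<and> b < length ps"
    then have "map (\<lambda>i. i - m) (swap_at a b ps) = swap_at a b (map (\<lambda>i. i - m) ps)"
      "set (swap_at a b ps) = set ps"
      by (simp_all add: map_swap_at set_swap_at)
    then show "pull \<omega> C z (swap_at a b ps) qs = - pull \<omega> C z ps qs"
      using ab alternatingD(1)[OF formsD(3)[OF \<omega>], of a b "map (\<lambda>i. i - m) ps"]
      by (simp add: pull_def pull_form_def meaningful_def)
  next
    fix C z and ps qs :: "nat list" and a b
    assume ab: "a < b \<and> b < length qs"
    then have "map (\<lambda>i. i - m) (swap_at a b qs) = swap_at a b (map (\<lambda>i. i - m) qs)"
      "set (swap_at a b qs) = set qs"
      by (simp_all add: map_swap_at set_swap_at)
    then show "pull \<omega> C z ps (swap_at a b qs) = - pull \<omega> C z ps qs"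
      using ab alternatingD(2)[OF formsD(3)[OF \<omega>], of a b "map (\<lambda>i. i - m) qs"]
      by (simp add: pull_def pull_form_def meaningful_def)
  qed
next
  show "compatible P (pull \<omega>)"
    unfolding compatible_def
  proof (intro ballI allI impI)
    fix C D z ps qs
    assume C: "C \<in> atlas P" and D: "D \<in> atlas P" and z: "z \<in> overlap C D"
      and ps: "set ps \<subseteq> {..<mdim P}" and qs: "set qs \<subseteq> {..<mdim P}"
    obtain c' where c: "rep C \<in> atlas M" "c' \<in> atlas L" "C = pc (rep C) c'"
      by (rule rep[OF C])
    obtain d' where d: "rep D \<in> atlas M" "d' \<in> atlas L" "D = pc (rep D) d'"
      by (rule rep[OF D])
    have z': "z \<in> overlap (pc (rep C) c') (pc (rep D) d')"
      using z c(3) d(3) by simp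
    let ?w = "chart_change C D z"
    have wD: "?w \<in> chart_image D"
      using chart_change_mem_P[OF c(1,2) d(1,2) z'] c(3) d(3) by simp
    have prw: "prM ?w = chart_change (rep C) (rep D) (prM z)"
      using change[OF c(1,2) d(1,2) z'] c(3) d(3) by simp
    have prz: "prM z \<in> overlap (rep C) (rep D)"
      using z' overlap[OF c(1,2) d(1,2)] by simp
    have zC: "z \<in> chart_image C"
      using z overlap_subset by blast
    have dzC: "dz i (\<lambda>w. chart_change C D w j) z =
        (if i \<in> {m..<m + n} then dz (i - m) (\<lambda>w. chart_change (rep C) (rep D) w (j - m)) (prM z) else 0)"
      if "i < mdim P" "j \<in> {m..<m + n}" for i j
      using dz_change(1)[OF c(1,2) d(1,2) z' that] c(3) d(3) by simp
    define A where "A ks = (\<Prod>a<length ps. dz (ps ! a) (\<lambda>w. chart_change C D w (ks ! a)) z)" for ks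
    define B where "B ls = (\<Prod>b<length qs. cnj (dz (qs ! b) (\<lambda>w. chart_change C D w (ls ! b)) z))" for ls
    \<comment> \<open>One entry of \<open>ps\<close> outside the block contributes a zero factor,
      hence the case distinction on the whole list.\<close>
    have A: "A (map ((+) m) ks) = (if set ps \<subseteq> {m..<m + n} then
        (\<Prod>a<length ps. dz (map (\<lambda>i. i - m) ps ! a) (\<lambda>w. chart_change (rep C) (rep D) w (ks ! a)) (prM z)) else 0)"
      if ks: "ks \<in> indices n (length ps)" for ks
    proof -
      have *: "dz (ps ! a) (\<lambda>w. chart_change C D w (map ((+) m) ks ! a)) z = (if ps ! a \<in> {m..<m + n} then
          dz (map (\<lambda>i. i - m) ps ! a) (\<lambda>w. chart_change (rep C) (rep D) w (ks ! a)) (prM z) else 0)"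
        if a: "a < length ps" for a
      proof -
        have "ks ! a < n"
          using ks a by (auto simp: indices_def subset_iff)
        moreover have "ps ! a < mdim P" "length ks = length ps"
          using ps a ks by (auto simp: indices_def subset_iff)
        ultimately show ?thesis
          using a by (simp add: dzC)
      qed
      show ?thesis
      proof (cases "set ps \<subseteq> {m..<m + n}")
        case True
        then have "ps ! a \<in> {m..<m + n}" if "a < length ps" for a
          using that nth_mem by blast
        then show ?thesis
          unfolding A_def if_P[OF True] by (intro prod.cong refl) (simp only: * if_True lessThan_iff)
      next
        case False
        then obtain a where "a < length ps" "ps ! a \<notin> {m..<m + n}"
          by (metis in_set_conv_nth subsetI)
        then have "A (map ((+) m) ks) = 0"
          unfolding A_def using *[of a] by (intro prod_zero) auto
        then show ?thesis using False by (simp only: if_False)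
      qed
    qed
    have B: "B (map ((+) m) ls) = (if set qs \<subseteq> {m..<m + n} then
        (\<Prod>b<length qs. cnj (dz (map (\<lambda>i. i - m) qs ! b) (\<lambda>w. chart_change (rep C) (rep D) w (ls ! b)) (prM z))) else 0)"
      if ls: "ls \<in> indices n (length qs)" for ls
    proof -
      have *: "dz (qs ! b) (\<lambda>w. chart_change C D w (map ((+) m) ls ! b)) z = (if qs ! b \<in> {m..<m + n} then
          dz (map (\<lambda>i. i - m) qs ! b) (\<lambda>w. chart_change (rep C) (rep D) w (ls ! b)) (prM z) else 0)"
        if b: "b < length qs" for b
      proof -
        have "ls ! b < n"
          using ls b by (auto simp: indices_def subset_iff)
        moreover have "qs ! b < mdim P" "length ls = length qs"
          using qs b ls by (auto simp: indices_def subset_iff)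
        ultimately show ?thesis
          using b by (simp add: dzC)
      qed
      show ?thesis
      proof (cases "set qs \<subseteq> {m..<m + n}")
        case True
        then have "qs ! b \<in> {m..<m + n}" if "b < length qs" for b
          using that nth_mem by blast
        then show ?thesis
          unfolding B_def if_P[OF True] by (intro prod.cong refl) (simp only: * if_True lessThan_iff)
      next
        case False
        then obtain b where "b < length qs" "qs ! b \<notin> {m..<m + n}"
          by (metis in_set_conv_nth subsetI)
        then have "B (map ((+) m) ls) = 0"
          unfolding B_def using *[of b] by (intro prod_zero) auto
        then show ?thesis using False by (simp only: if_False)
      qed
    qed
    have pullw: "pull \<omega> D ?w (map ((+) m) ks) (map ((+) m) ls) = \<omega> (rep D) (prM ?w) ks ls"
      if "ks \<in> indices n (length ps)" "ls \<in> indices n (length qs)" for ks ls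
    proof -
      have sets: "set ks \<subseteq> {..<n}" "set ls \<subseteq> {..<n}"
        using that by (auto simp: indices_def)
      have "meaningful P D ?w (map ((+) m) ks) (map ((+) m) ls)"
        unfolding meaningful_def using D wD map_add_range_P[OF sets(1)] map_add_range_P[OF sets(2)] by blast
      then show ?thesis
        unfolding pull_def pull_form_def map_diff_add
        using map_add_range[OF sets(1)] map_add_range[OF sets(2)] by (simp only: if_True simp_thms)
    qed
    \<comment> \<open>The pullback vanishes on index lists that leave the block, so both sums shrink
      to lists of the factor, the outer one before the inner one.\<close>
    have "(\<Sum>ks\<in>indices (mdim P) (length ps). \<Sum>ls\<in>indices (mdim P) (length qs). A ks * B ls * pull \<omega> D ?w ks ls)
        = (\<Sum>ks\<in>indices n (length ps). \<Sum>ls\<in>indices (mdim P) (length qs). A (map ((+) m) ks) * B ls * pull \<omega> D ?w (map ((+) m) ks) ls)"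
      by (rule sum_indices_shift[OF ranges(1)]) (simp add: pull_def pull_form_def)
    also have "\<dots> = (\<Sum>ks\<in>indices n (length ps). \<Sum>ls\<in>indices n (length qs).
        A (map ((+) m) ks) * B (map ((+) m) ls) * pull \<omega> D ?w (map ((+) m) ks) (map ((+) m) ls))"
      by (intro sum.cong refl sum_indices_shift[OF ranges(1)]) (simp add: pull_def pull_form_def)
    also have "\<dots> = (\<Sum>ks\<in>indices n (length ps). \<Sum>ls\<in>indices n (length qs).
        A (map ((+) m) ks) * B (map ((+) m) ls) * \<omega> (rep D) (prM ?w) ks ls)"
      by (intro sum.cong refl) (simp only: pullw)
    also have "\<dots> = pull \<omega> C z ps qs"
    proof (cases "set ps \<subseteq> {m..<m + n} \<and> set qs \<subseteq> {m..<m + n}")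
      case True
      then have "pull \<omega> C z ps qs = \<omega> (rep C) (prM z) (map (\<lambda>i. i - m) ps) (map (\<lambda>i. i - m) qs)"
        using C zC ps qs by (simp add: pull_def pull_form_def meaningful_def)
      also have "\<dots> = (\<Sum>ks\<in>indices n (length ps). \<Sum>ls\<in>indices n (length qs).
          A (map ((+) m) ks) * B (map ((+) m) ls) * \<omega> (rep D) (prM ?w) ks ls)"
        unfolding prw
        using compatibleD[OF formsD(4)[OF \<omega>] c(1) d(1) prz map_diff_range[of ps] map_diff_range[of qs]] True
        by (simp add: A B cong: sum.cong)
      finally show ?thesis ..
    next
      case False
      then have "pull \<omega> C z ps qs = 0"
        unfolding pull_def pull_form_def by (intro if_not_P) blast
      moreover have "A (map ((+) m) ks) * B (map ((+) m) ls) = 0"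
        if "ks \<in> indices n (length ps)" "ls \<in> indices n (length qs)" for ks ls
        using False unfolding A[OF that(1)] B[OF that(2)]
        by (cases "set ps \<subseteq> {m..<m + n}") (simp_all only: if_False mult_zero_left mult_zero_right simp_thms)
      then have "(\<Sum>ks\<in>indices n (length ps). \<Sum>ls\<in>indices n (length qs).
          A (map ((+) m) ks) * B (map ((+) m) ls) * \<omega> (rep D) (prM ?w) ks ls) = 0"
        by (intro sum.neutral ballI) (simp only: mult_zero_left)
      ultimately show ?thesis
        by (simp only:)
    qed
    finally show "pull \<omega> C z ps qs = (\<Sum>ks\<in>indices (mdim P) (length ps). \<Sum>ls\<in>indices (mdim P) (length qs).
            (\<Prod>a<length ps. dz (ps ! a) (\<lambda>w. chart_change C D w (ks ! a)) z) *
            (\<Prod>b<length qs. cnj (dz (qs ! b) (\<lambda>w. chart_change C D w (ls ! b)) z)) *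
            pull \<omega> D (chart_change C D z) ks ls)"
      unfolding A_def B_def ..
  qed
qed

text \<open>On the chart image the component factors through \<open>prM\<close>, so derivatives in
  the directions of \<open>L\<close> vanish.\<close>

lemma wirtinger_pull:
  assumes C: "C \<in> atlas P" and z: "z \<in> chart_image C" and i: "i < mdim P"
    and ps: "set ps \<subseteq> {..<mdim P}" and qs: "set qs \<subseteq> {..<mdim P}"
  shows "dz i (\<lambda>w. pull \<omega> C w ps qs) z =
      (if i \<in> {m..<m + n} \<and> set ps \<subseteq> {m..<m + n} \<and> set qs \<subseteq> {m..<m + n}
       then dz (i - m) (\<lambda>w. \<omega> (rep C) w (map (\<lambda>i. i - m) ps) (map (\<lambda>i. i - m) qs)) (prM z) else 0)"
    and "dzbar i (\<lambda>w. pull \<omega> C w ps qs) z =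
      (if i \<in> {m..<m + n} \<and> set ps \<subseteq> {m..<m + n} \<and> set qs \<subseteq> {m..<m + n}
       then dzbar (i - m) (\<lambda>w. \<omega> (rep C) w (map (\<lambda>i. i - m) ps) (map (\<lambda>i. i - m) qs)) (prM z) else 0)"
proof -
  \<comment> \<open>The range condition on \<open>ps\<close> and \<open>qs\<close> does not depend
    on the point. Placed inside \<open>F\<close>, it lets one formula cover all cases.\<close>
  define F where "F = (\<lambda>w. if set ps \<subseteq> {m..<m + n} \<and> set qs \<subseteq> {m..<m + n}
    then \<omega> (rep C) w (map (\<lambda>i. i - m) ps) (map (\<lambda>i. i - m) qs) else 0)"
  have F: "pull \<omega> C w ps qs = F (prM w)" if "w \<in> chart_image C" for w
    using that C ps qs by (simp add: pull_def pull_form_def meaningful_def F_def)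
  have "dz i (\<lambda>w. pull \<omega> C w ps qs) z = (if i \<in> {m..<m + n} then dz (i - m) F (prM z) else 0)"
    using dz_cong[OF chart_image_open_P[OF C] z i, of "\<lambda>w. pull \<omega> C w ps qs" "\<lambda>w. F (prM w)"] F
      dz_pr(1)[OF i, of F z] by (simp only:)
  then show "dz i (\<lambda>w. pull \<omega> C w ps qs) z =
      (if i \<in> {m..<m + n} \<and> set ps \<subseteq> {m..<m + n} \<and> set qs \<subseteq> {m..<m + n}
       then dz (i - m) (\<lambda>w. \<omega> (rep C) w (map (\<lambda>i. i - m) ps) (map (\<lambda>i. i - m) qs)) (prM z) else 0)"
    unfolding F_def
    by (cases "set ps \<subseteq> {m..<m + n} \<and> set qs \<subseteq> {m..<m + n}"; cases "i \<in> {m..<m + n}")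
      (simp_all only: if_True if_False simp_thms dz_const dzbar_const)
  have "dzbar i (\<lambda>w. pull \<omega> C w ps qs) z = (if i \<in> {m..<m + n} then dzbar (i - m) F (prM z) else 0)"
    using dzbar_cong[OF chart_image_open_P[OF C] z i, of "\<lambda>w. pull \<omega> C w ps qs" "\<lambda>w. F (prM w)"] F
      dz_pr(2)[OF i, of F z] by (simp only:)
  then show "dzbar i (\<lambda>w. pull \<omega> C w ps qs) z =
      (if i \<in> {m..<m + n} \<and> set ps \<subseteq> {m..<m + n} \<and> set qs \<subseteq> {m..<m + n}
       then dzbar (i - m) (\<lambda>w. \<omega> (rep C) w (map (\<lambda>i. i - m) ps) (map (\<lambda>i. i - m) qs)) (prM z) else 0)"
    unfolding F_def
    by (cases "set ps \<subseteq> {m..<m + n} \<and> set qs \<subseteq> {m..<m + n}"; cases "i \<in> {m..<m + n}")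
      (simp_all only: if_True if_False simp_thms dz_const dzbar_const)
qed

lemma meaningful_pr:
  assumes "meaningful P C z ps qs" "set ps \<subseteq> {m..<m + n}" "set qs \<subseteq> {m..<m + n}"
  shows "meaningful M (rep C) (prM z) (map (\<lambda>i. i - m) ps) (map (\<lambda>i. i - m) qs)"
proof -
  have C: "C \<in> atlas P" "z \<in> chart_image C"
    using assms(1) by (auto simp: meaningful_def)
  obtain c' where c: "rep C \<in> atlas M" "c' \<in> atlas L" "C = pc (rep C) c'"
    by (rule rep[OF C(1)])
  have "prM z \<in> chart_image (rep C)"
    using chart_image_pc[OF c(1,2)] c(3) C(2) by simp
  then show ?thesis
    using c(1) map_diff_range[OF assms(2)] map_diff_range[OF assms(3)] by (simp add: meaningful_def)
qed

text \<open>Shifting keeps the positions of the indices and hence the signs. If an index leaves the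
  block of \<open>M\<close>, either the derivative is in a direction of \<open>L\<close> or the
  differentiated component is 0.\<close>

lemma del_pull: "del P (pull \<omega>) = pull (del M \<omega>)"
proof -
  have "del P (pull \<omega>) C z ps qs = pull (del M \<omega>) C z ps qs" for C z ps qs
  proof (cases "meaningful P C z ps qs")
    case True
    then have C: "C \<in> atlas P" "z \<in> chart_image C" and sets: "set ps \<subseteq> {..<mdim P}" "set qs \<subseteq> {..<mdim P}"
      by (auto simp: meaningful_def)
    have wi: "dz (ps ! a) (\<lambda>w. pull \<omega> C w (omit a ps) qs) z =
        (if set ps \<subseteq> {m..<m + n} \<and> set qs \<subseteq> {m..<m + n} then
          dz (map (\<lambda>i. i - m) ps ! a) (\<lambda>w. \<omega> (rep C) w (omit a (map (\<lambda>i. i - m) ps)) (map (\<lambda>i. i - m) qs)) (prM z)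
         else 0)" if a: "a < length ps" for a
    proof -
      have "ps ! a < mdim P" "set (omit a ps) \<subseteq> {..<mdim P}"
        using sets(1) a nth_mem set_omit_subset[of a ps] by blast+
      from wirtinger_pull(1)[OF C this sets(2)]
      show ?thesis
        unfolding insert_nth_set_omit[OF a, symmetric] using a by (simp add: omit_map)
    qed
    show ?thesis
    proof (cases "set ps \<subseteq> {m..<m + n} \<and> set qs \<subseteq> {m..<m + n}")
      case in_range: True
      then have "pull (del M \<omega>) C z ps qs = del M \<omega> (rep C) (prM z) (map (\<lambda>i. i - m) ps) (map (\<lambda>i. i - m) qs)"
        using True by (simp add: pull_def pull_form_def)
      also have "\<dots> = (\<Sum>a<length ps. (-1) ^ a *
          dz (map (\<lambda>i. i - m) ps ! a) (\<lambda>w. \<omega> (rep C) w (omit a (map (\<lambda>i. i - m) ps)) (map (\<lambda>i. i - m) qs)) (prM z))"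
        using meaningful_pr[OF True] in_range by (simp add: del_def)
      also have "\<dots> = (\<Sum>a<length ps. (-1) ^ a * dz (ps ! a) (\<lambda>w. pull \<omega> C w (omit a ps) qs) z)"
        by (intro sum.cong refl) (simp add: wi in_range)
      finally show ?thesis
        using True by (simp add: del_def)
    next
      case False
      then have "pull (del M \<omega>) C z ps qs = 0"
        unfolding pull_def pull_form_def by (intro if_not_P) blast
      moreover have "(\<Sum>a<length ps. (-1) ^ a * dz (ps ! a) (\<lambda>w. pull \<omega> C w (omit a ps) qs) z) = 0"
        by (intro sum.neutral ballI) (use False wi in \<open>simp only: lessThan_iff if_False mult_zero_right\<close>)
      ultimately show ?thesis
        using True by (simp add: del_def)
    qed
  next
    case False
    then show ?thesis
      by (simp add: del_def pull_def pull_form_def)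
  qed
  then show ?thesis by (intro ext)
qed

lemma delbar_pull: "delbar P (pull \<omega>) = pull (delbar M \<omega>)"
proof -
  have "delbar P (pull \<omega>) C z ps qs = pull (delbar M \<omega>) C z ps qs" for C z ps qs
  proof (cases "meaningful P C z ps qs")
    case True
    then have C: "C \<in> atlas P" "z \<in> chart_image C" and sets: "set ps \<subseteq> {..<mdim P}" "set qs \<subseteq> {..<mdim P}"
      by (auto simp: meaningful_def)
    have wi: "dzbar (qs ! b) (\<lambda>w. pull \<omega> C w ps (omit b qs)) z =
        (if set ps \<subseteq> {m..<m + n} \<and> set qs \<subseteq> {m..<m + n} then
          dzbar (map (\<lambda>i. i - m) qs ! b) (\<lambda>w. \<omega> (rep C) w (map (\<lambda>i. i - m) ps) (omit b (map (\<lambda>i. i - m) qs))) (prM z)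
         else 0)" if b: "b < length qs" for b
    proof -
      have "qs ! b < mdim P" "set (omit b qs) \<subseteq> {..<mdim P}"
        using sets(2) b nth_mem set_omit_subset[of b qs] by blast+
      from wirtinger_pull(2)[OF C this(1) sets(1) this(2)]
      show ?thesis
        unfolding insert_nth_set_omit[OF b, symmetric] using b by (auto simp: omit_map)
    qed
    show ?thesis
    proof (cases "set ps \<subseteq> {m..<m + n} \<and> set qs \<subseteq> {m..<m + n}")
      case in_range: True
      then have "pull (delbar M \<omega>) C z ps qs = delbar M \<omega> (rep C) (prM z) (map (\<lambda>i. i - m) ps) (map (\<lambda>i. i - m) qs)"
        using True by (simp add: pull_def pull_form_def)
      also have "\<dots> = (-1) ^ length ps * (\<Sum>b<length qs. (-1) ^ b *
          dzbar (map (\<lambda>i. i - m) qs ! b) (\<lambda>w. \<omega> (rep C) w (map (\<lambda>i. i - m) ps) (omit b (map (\<lambda>i. i - m) qs))) (prM z))"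
        using meaningful_pr[OF True] in_range by (simp add: delbar_def)
      also have "\<dots> = (-1) ^ length ps * (\<Sum>b<length qs. (-1) ^ b * dzbar (qs ! b) (\<lambda>w. pull \<omega> C w ps (omit b qs)) z)"
        by (intro arg_cong2[of _ _ _ _ "(*)"] sum.cong refl) (simp add: wi in_range)
      finally show ?thesis
        using True by (simp add: delbar_def)
    next
      case False
      then have "pull (delbar M \<omega>) C z ps qs = 0"
        unfolding pull_def pull_form_def by (intro if_not_P) blast
      moreover have "(\<Sum>b<length qs. (-1) ^ b * dzbar (qs ! b) (\<lambda>w. pull \<omega> C w ps (omit b qs)) z) = 0"
        by (intro sum.neutral ballI) (use False wi in \<open>simp only: lessThan_iff if_False mult_zero_right\<close>)
      ultimately show ?thesis
        using True by (simp add: delbar_def)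
    qed
  next
    case False
    then show ?thesis
      by (simp add: delbar_def pull_def pull_form_def)
  qed
  then show ?thesis by (intro ext)
qed

end

text \<open>
  The slice consists of the points of which the component in \<open>L\<close> has the coordinates \<open>w0\<close> in the
  chart \<open>c0\<close>.
\<close>

locale product_slice = product_factor P M L pc m k
  for P :: "'p manifold" and M :: "'m manifold" and L :: "'l manifold"
    and pc :: "'m chart \<Rightarrow> 'l chart \<Rightarrow> 'p chart" and m k :: nat +
  fixes c0 :: "'l chart" and w0 :: "nat \<Rightarrow> complex"
  assumes c0: "c0 \<in> atlas L" and w0: "w0 \<in> chart_image c0"
begin

definition slice :: "'p form \<Rightarrow> 'm form" where
  "slice = slice_form M (\<lambda>c. pc c c0) (\<lambda>z. glue z w0) m"

section \<open>Restriction of forms to a slice\<close>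

lemma slice_chart_image:
  assumes "c \<in> atlas M" "z \<in> chart_image c"
  shows "glue z w0 \<in> chart_image (pc c c0)" "prM (glue z w0) = z"
  using glue_chart_image[OF assms(1) c0 assms(2) w0] by simp_all

lemma slice_overlap:
  assumes "c \<in> atlas M" "d \<in> atlas M" "z \<in> overlap c d"
  shows "glue z w0 \<in> overlap (pc c c0) (pc d c0)"
    "chart_change (pc c c0) (pc d c0) (glue z w0) = glue (chart_change c d z) w0"
proof -
  have "w0 \<in> overlap c0 c0"
    using w0 by (simp add: overlap_self)
  from glue_overlap[OF assms(1) c0 assms(2) c0 assms(3) this]
  show "glue z w0 \<in> overlap (pc c c0) (pc d c0)"
    "chart_change (pc c c0) (pc d c0) (glue z w0) = glue (chart_change c d z) w0"
    using chart_change_self[OF w0] by simp_all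
qed

lemma meaningful_slice:
  assumes "meaningful M c z ps qs"
  shows "meaningful P (pc c c0) (glue z w0) (map ((+) m) ps) (map ((+) m) qs)"
proof -
  have "c \<in> atlas M" "z \<in> chart_image c" "set ps \<subseteq> {..<n}" "set qs \<subseteq> {..<n}"
    using assms by (auto simp: meaningful_def)
  then show ?thesis
    unfolding meaningful_def
    using pc_atlas[OF _ c0] slice_chart_image(1) map_add_range_P by blast
qed

text \<open>The chart \<open>c0\<close> is kept, so \<open>w0\<close> is unchanged under changes of
  coordinates. Directions along \<open>M\<close> have zero derivative into the block of
  \<open>L\<close>, which reduces the transformation law to that of \<open>M\<close>.\<close>

lemma slice_form_in_forms:
  assumes \<omega>: "\<omega> \<in> forms P p q"
  shows "slice \<omega> \<in> forms M p q"
  unfolding forms_def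
proof (intro CollectI conjI allI impI ballI)
  fix c z ps qs
  assume "\<not> (meaningful M c z ps qs \<and> int (length ps) = p \<and> int (length qs) = q)"
  then show "slice \<omega> c z ps qs = 0"
    using formsD(1)[OF \<omega>] by (auto simp: slice_def slice_form_def)
next
  fix c ps qs assume c: "c \<in> atlas M"
  show "smooth_on n (chart_image c) (\<lambda>z. slice \<omega> c z ps qs)"
  proof (cases "set ps \<subseteq> {..<n} \<and> set qs \<subseteq> {..<n}")
    case True
    then have "\<omega> (pc c c0) (glue z w0) (map ((+) m) ps) (map ((+) m) qs) = slice \<omega> c z ps qs"
      if "z \<in> chart_image c" for z
      using True c that by (simp add: slice_def slice_form_def meaningful_def)
    moreover have "smooth_on n (chart_image c)
        (\<lambda>z. \<omega> (pc c c0) (glue z w0) (map ((+) m) ps) (map ((+) m) qs))"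
      by (rule smooth_on_subst[OF coord_subst_join_left[OF ranges(1)] _ formsD(2)[OF \<omega> pc_atlas[OF c c0]]])
        (rule slice_chart_image(1)[OF c])
    ultimately show ?thesis
      by (rule smooth_on_cong[OF chart_image_open[OF M c]])
  next
    case False
    then have "(\<lambda>z. slice \<omega> c z ps qs) = (\<lambda>z. 0)"
      unfolding slice_def slice_form_def meaningful_def by (intro ext if_not_P) blast
    then show ?thesis
      by (simp only: smooth_on_const)
  qed
next
  show "alternating (slice \<omega>)"
    unfolding alternating_def
  proof (intro allI impI conjI)
    fix C z and ps qs :: "nat list" and a b
    assume ab: "a < b \<and> b < length ps"
    then have "map ((+) m) (swap_at a b ps) = swap_at a b (map ((+) m) ps)"
      "set (swap_at a b ps) = set ps"
      by (simp_all add: map_swap_at set_swap_at)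
    then show "slice \<omega> C z (swap_at a b ps) qs = - slice \<omega> C z ps qs"
      using ab alternatingD(1)[OF formsD(3)[OF \<omega>], of a b "map ((+) m) ps"]
      by (simp add: slice_def slice_form_def meaningful_def)
  next
    fix C z and ps qs :: "nat list" and a b
    assume ab: "a < b \<and> b < length qs"
    then have "map ((+) m) (swap_at a b qs) = swap_at a b (map ((+) m) qs)"
      "set (swap_at a b qs) = set qs"
      by (simp_all add: map_swap_at set_swap_at)
    then show "slice \<omega> C z ps (swap_at a b qs) = - slice \<omega> C z ps qs"
      using ab alternatingD(2)[OF formsD(3)[OF \<omega>], of a b "map ((+) m) qs"]
      by (simp add: slice_def slice_form_def meaningful_def)
  qed
next
  show "compatible M (slice \<omega>)"
    unfolding compatible_def
  proof (intro ballI allI impI)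
    fix c d z ps qs
    assume c: "c \<in> atlas M" and d: "d \<in> atlas M" and z: "z \<in> overlap c d"
      and ps: "set ps \<subseteq> {..<n}" and qs: "set qs \<subseteq> {..<n}"
    let ?C = "pc c c0" and ?D = "pc d c0" and ?z = "glue z w0" and ?w = "chart_change c d z"
    have zc: "z \<in> chart_image c"
      using z overlap_subset by blast
    have wd: "?w \<in> chart_image d"
      by (rule chart_change_mem[OF M c z])
    note ov = slice_overlap[OF c d z]
    have dzC: "dz (m + i) (\<lambda>w. chart_change ?C ?D w j) ?z =
        (if j \<in> {m..<m + n} then dz i (\<lambda>w. chart_change c d w (j - m)) z else 0)"
      if i: "i < n" and j: "j < mdim P" for i j
    proof -
      have mi: "m + i < mdim P" "m + i \<in> {m..<m + n}" "m + i \<notin> {k..<k + l}"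
        using i ranges by (auto simp: disjoint_iff)
      show ?thesis
      proof (cases "j \<in> {m..<m + n}")
        case True
        then show ?thesis
          using dz_change(1)[OF c c0 d c0 ov(1) mi(1) True] mi(2) slice_chart_image(2)[OF c zc] by simp
      next
        case False
        then have jk: "j \<in> {k..<k + l}"
          using ranges(4)[OF j] by blast
        show ?thesis
          unfolding dz_change(2)[OF c c0 d c0 ov(1) mi(1) jk] using mi(3) False by (simp only: if_False)
      qed
    qed
    define A where "A ks = (\<Prod>a<length ps. dz (map ((+) m) ps ! a) (\<lambda>w. chart_change ?C ?D w (ks ! a)) ?z)" for ks
    define B where "B ls = (\<Prod>b<length qs. cnj (dz (map ((+) m) qs ! b) (\<lambda>w. chart_change ?C ?D w (ls ! b)) ?z))" for ls
    \<comment> \<open>Unlike a pullback, \<omega> may be nonzero on index lists that leave the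
      block; here the Jacobian factors remove those terms.\<close>
    have A0: "A ks = 0" if ks: "ks \<in> indices (mdim P) (length ps)" "\<not> set ks \<subseteq> {m..<m + n}" for ks
    proof -
      obtain j where "j \<in> set ks" "j \<notin> {m..<m + n}"
        using ks(2) by blast
      then obtain a where "a < length ks" "ks ! a \<notin> {m..<m + n}"
        by (metis in_set_conv_nth)
      then have a: "a < length ps" "ks ! a \<notin> {m..<m + n}"
        using ks(1) by (simp_all add: indices_def)
      moreover have "ks ! a < mdim P"
        using ks a by (auto simp: indices_def subset_iff)
      moreover have "ps ! a < n"
        using ps a(1) nth_mem by blast
      ultimately have "dz (map ((+) m) ps ! a) (\<lambda>w. chart_change ?C ?D w (ks ! a)) ?z = 0"
        by (simp only: nth_map dzC if_False)
      then show ?thesis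
        unfolding A_def using a(1) by (intro prod_zero) auto
    qed
    have B0: "B ls = 0" if ls: "ls \<in> indices (mdim P) (length qs)" "\<not> set ls \<subseteq> {m..<m + n}" for ls
    proof -
      obtain j where "j \<in> set ls" "j \<notin> {m..<m + n}"
        using ls(2) by blast
      then obtain b where "b < length ls" "ls ! b \<notin> {m..<m + n}"
        by (metis in_set_conv_nth)
      then have b: "b < length qs" "ls ! b \<notin> {m..<m + n}"
        using ls(1) by (simp_all add: indices_def)
      moreover have "ls ! b < mdim P"
        using ls b by (auto simp: indices_def subset_iff)
      moreover have "qs ! b < n"
        using qs b(1) nth_mem by blast
      ultimately have "dz (map ((+) m) qs ! b) (\<lambda>w. chart_change ?C ?D w (ls ! b)) ?z = 0"
        by (simp only: nth_map dzC if_False)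
      then show ?thesis
        unfolding B_def using b(1) by (intro prod_zero) auto
    qed
    have dzm: "dz (map ((+) m) xs ! a) (\<lambda>w. chart_change ?C ?D w (map ((+) m) ks ! a)) ?z =
        dz (xs ! a) (\<lambda>w. chart_change c d w (ks ! a)) z"
      if "set xs \<subseteq> {..<n}" "ks \<in> indices n (length xs)" "a < length xs" for xs ks a
    proof -
      have "xs ! a < n" "length ks = length xs" "ks ! a < n"
        using that by (auto simp: indices_def subset_iff)
      then show ?thesis
        using that(3) ranges(1) by (simp add: dzC)
    qed
    have A: "A (map ((+) m) ks) = (\<Prod>a<length ps. dz (ps ! a) (\<lambda>w. chart_change c d w (ks ! a)) z)"
      if "ks \<in> indices n (length ps)" for ks
      unfolding A_def by (intro prod.cong refl) (simp only: dzm[OF ps that] lessThan_iff)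
    have B: "B (map ((+) m) ls) = (\<Prod>b<length qs. cnj (dz (qs ! b) (\<lambda>w. chart_change c d w (ls ! b)) z))"
      if "ls \<in> indices n (length qs)" for ls
      unfolding B_def by (intro prod.cong refl) (simp only: dzm[OF qs that] lessThan_iff)
    have slicew: "\<omega> ?D (glue ?w w0) (map ((+) m) ks) (map ((+) m) ls) = slice \<omega> d ?w ks ls"
      if "ks \<in> indices n (length ps)" "ls \<in> indices n (length qs)" for ks ls
      using that d wd by (simp add: slice_def slice_form_def meaningful_def indices_def)
    have "slice \<omega> c z ps qs = \<omega> ?C ?z (map ((+) m) ps) (map ((+) m) qs)"
      using c zc ps qs by (simp add: slice_def slice_form_def meaningful_def)
    also have "\<dots> = (\<Sum>ks\<in>indices (mdim P) (length ps). \<Sum>ls\<in>indices (mdim P) (length qs).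
        A ks * B ls * \<omega> ?D (glue ?w w0) ks ls)"
      unfolding A_def B_def
      using compatibleD[OF formsD(4)[OF \<omega>] pc_atlas[OF c c0] pc_atlas[OF d c0] ov(1)
          map_add_range_P[OF ps] map_add_range_P[OF qs]] unfolding ov(2) length_map .
    also have "\<dots> = (\<Sum>ks\<in>indices n (length ps). \<Sum>ls\<in>indices (mdim P) (length qs).
        A (map ((+) m) ks) * B ls * \<omega> ?D (glue ?w w0) (map ((+) m) ks) ls)"
      by (rule sum_indices_shift[OF ranges(1)]) (simp add: A0)
    also have "\<dots> = (\<Sum>ks\<in>indices n (length ps). \<Sum>ls\<in>indices n (length qs).
        A (map ((+) m) ks) * B (map ((+) m) ls) * \<omega> ?D (glue ?w w0) (map ((+) m) ks) (map ((+) m) ls))"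
      by (intro sum.cong refl sum_indices_shift[OF ranges(1)]) (simp add: B0)
    also have "\<dots> = (\<Sum>ks\<in>indices n (length ps). \<Sum>ls\<in>indices n (length qs).
            (\<Prod>a<length ps. dz (ps ! a) (\<lambda>w. chart_change c d w (ks ! a)) z) *
            (\<Prod>b<length qs. cnj (dz (qs ! b) (\<lambda>w. chart_change c d w (ls ! b)) z)) *
            slice \<omega> d ?w ks ls)"
      by (intro sum.cong refl) (simp only: A B slicew)
    finally show "slice \<omega> c z ps qs = \<dots>" .
  qed
qed

lemma wirtinger_slice:
  assumes c: "c \<in> atlas M" and z: "z \<in> chart_image c" and i: "i < n"
    and ps: "set ps \<subseteq> {..<n}" and qs: "set qs \<subseteq> {..<n}"
  shows "dz i (\<lambda>w. slice \<omega> c w ps qs) z =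
      dz (m + i) (\<lambda>w. \<omega> (pc c c0) w (map ((+) m) ps) (map ((+) m) qs)) (glue z w0)"
    and "dzbar i (\<lambda>w. slice \<omega> c w ps qs) z =
      dzbar (m + i) (\<lambda>w. \<omega> (pc c c0) w (map ((+) m) ps) (map ((+) m) qs)) (glue z w0)"
proof -
  define F where "F = (\<lambda>w. \<omega> (pc c c0) w (map ((+) m) ps) (map ((+) m) qs))"
  have F: "slice \<omega> c w ps qs = F (glue w w0)" if "w \<in> chart_image c" for w
    using that c ps qs by (simp add: slice_def slice_form_def meaningful_def F_def)
  show "dz i (\<lambda>w. slice \<omega> c w ps qs) z =
      dz (m + i) (\<lambda>w. \<omega> (pc c c0) w (map ((+) m) ps) (map ((+) m) qs)) (glue z w0)"
    using dz_cong[OF chart_image_open[OF M c] z i, of "\<lambda>w. slice \<omega> c w ps qs" "\<lambda>w. F (glue w w0)"] F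
      dz_glue(1)[OF i, of F w0 z] by (simp only: F_def)
  show "dzbar i (\<lambda>w. slice \<omega> c w ps qs) z =
      dzbar (m + i) (\<lambda>w. \<omega> (pc c c0) w (map ((+) m) ps) (map ((+) m) qs)) (glue z w0)"
    using dzbar_cong[OF chart_image_open[OF M c] z i, of "\<lambda>w. slice \<omega> c w ps qs" "\<lambda>w. F (glue w w0)"] F
      dz_glue(2)[OF i, of F w0 z] by (simp only: F_def)
qed

lemma del_slice: "del M (slice \<omega>) = slice (del P \<omega>)"
proof -
  have "del M (slice \<omega>) c z ps qs = slice (del P \<omega>) c z ps qs" for c z ps qs
  proof (cases "meaningful M c z ps qs")
    case True
    then have c: "c \<in> atlas M" "z \<in> chart_image c" and sets: "set ps \<subseteq> {..<n}" "set qs \<subseteq> {..<n}"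
      by (auto simp: meaningful_def)
    have wi: "dz (ps ! a) (\<lambda>w. slice \<omega> c w (omit a ps) qs) z =
        dz (map ((+) m) ps ! a) (\<lambda>w. \<omega> (pc c c0) w (omit a (map ((+) m) ps)) (map ((+) m) qs)) (glue z w0)"
      if a: "a < length ps" for a
    proof -
      have "ps ! a < n" "set (omit a ps) \<subseteq> {..<n}"
        using sets(1) a nth_mem set_omit_subset[of a ps] by blast+
      from wirtinger_slice(1)[OF c this sets(2)] show ?thesis
        using a by (simp add: omit_map)
    qed
    have "del M (slice \<omega>) c z ps qs = (\<Sum>a<length ps. (-1) ^ a *
        dz (map ((+) m) ps ! a) (\<lambda>w. \<omega> (pc c c0) w (omit a (map ((+) m) ps)) (map ((+) m) qs)) (glue z w0))"
      unfolding del_def if_P[OF True] by (intro sum.cong refl) (simp only: wi lessThan_iff)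
    then show ?thesis
      using True meaningful_slice[OF True] by (simp add: slice_def slice_form_def del_def)
  next
    case False
    then show ?thesis
      by (simp add: del_def slice_def slice_form_def)
  qed
  then show ?thesis by (intro ext)
qed

lemma delbar_slice: "delbar M (slice \<omega>) = slice (delbar P \<omega>)"
proof -
  have "delbar M (slice \<omega>) c z ps qs = slice (delbar P \<omega>) c z ps qs" for c z ps qs
  proof (cases "meaningful M c z ps qs")
    case True
    then have c: "c \<in> atlas M" "z \<in> chart_image c" and sets: "set ps \<subseteq> {..<n}" "set qs \<subseteq> {..<n}"
      by (auto simp: meaningful_def)
    have wi: "dzbar (qs ! b) (\<lambda>w. slice \<omega> c w ps (omit b qs)) z =
        dzbar (map ((+) m) qs ! b) (\<lambda>w. \<omega> (pc c c0) w (map ((+) m) ps) (omit b (map ((+) m) qs))) (glue z w0)"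
      if b: "b < length qs" for b
    proof -
      have "qs ! b < n" "set (omit b qs) \<subseteq> {..<n}"
        using sets(2) b nth_mem set_omit_subset[of b qs] by blast+
      from wirtinger_slice(2)[OF c this(1) sets(1) this(2)] show ?thesis
        using b by (simp add: omit_map)
    qed
    have "delbar M (slice \<omega>) c z ps qs = (-1) ^ length ps * (\<Sum>b<length qs. (-1) ^ b *
        dzbar (map ((+) m) qs ! b) (\<lambda>w. \<omega> (pc c c0) w (map ((+) m) ps) (omit b (map ((+) m) qs))) (glue z w0))"
      unfolding delbar_def if_P[OF True]
      by (intro arg_cong2[of _ _ _ _ "(*)"] sum.cong refl) (simp only: wi lessThan_iff)
    then show ?thesis
      using True meaningful_slice[OF True] by (simp add: slice_def slice_form_def delbar_def)
  next
    case False
    then show ?thesis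
      by (simp add: delbar_def slice_def slice_form_def)
  qed
  then show ?thesis by (intro ext)
qed

text \<open>The composition evaluates \<omega> in the chosen chart \<open>rep (pc c c0)\<close>
  instead of \<open>c\<close>; \<open>rep_same_chart\<close> identifies the two values.\<close>

lemma slice_pull:
  assumes \<omega>: "\<omega> \<in> forms M p q"
  shows "slice (pull \<omega>) = \<omega>"
proof -
  have "slice (pull \<omega>) c z ps qs = \<omega> c z ps qs" for c z ps qs
  proof (cases "meaningful M c z ps qs")
    case True
    then have c: "c \<in> atlas M" "z \<in> chart_image c" and sets: "set ps \<subseteq> {..<n}" "set qs \<subseteq> {..<n}"
      by (auto simp: meaningful_def)
    have "slice (pull \<omega>) c z ps qs = pull \<omega> (pc c c0) (glue z w0) (map ((+) m) ps) (map ((+) m) qs)"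
      using True by (simp only: slice_def slice_form_def if_True)
    also have "\<dots> = \<omega> (rep (pc c c0)) z ps qs"
      using meaningful_slice[OF True] map_add_range[OF sets(1)] map_add_range[OF sets(2)]
      unfolding pull_def pull_form_def map_diff_add slice_chart_image(2)[OF c] by (simp only: if_True simp_thms)
    also have "\<dots> = \<omega> c z ps qs"
      by (rule rep_same_chart[OF \<omega> c(1) c0 c(2)]) (use slice_chart_image(1)[OF c] in blast)
    finally show ?thesis .
  next
    case False
    then show ?thesis
      using formsD(1)[OF \<omega>] by (simp add: slice_def slice_form_def)
  qed
  then show ?thesis by (intro ext)
qed

text \<open>
  By \<open>del P \<alpha> = 0\<close> the coefficients are antiholomorphic. Those in the directions of one factor do
  not change under coordinate changes of the other factor, so they define functions on it.
\<close>

lemma coefficient_constant: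
  assumes cL: "compact_connected_complex_manifold L"
    and \<alpha>: "\<alpha> \<in> forms P 0 1" "del P \<alpha> = 0" and i: "i \<in> {m..<m + n}"
    and c: "c \<in> atlas M" "z \<in> chart_image c"
    and d: "d \<in> atlas L" "w \<in> chart_image d" and d': "d' \<in> atlas L" "w' \<in> chart_image d'"
  shows "\<alpha> (pc c d) (glue z w) [] [i] = \<alpha> (pc c d') (glue z w') [] [i]"
proof -
  have iP: "i < mdim P"
    using i ranges(1) by auto
  show ?thesis
  proof (rule antiholomorphic_function_constant[OF cL, where g = "\<lambda>d w. \<alpha> (pc c d) (glue z w) [] [i]"])
    fix d assume d: "d \<in> atlas L"
    show "smooth_on l (chart_image d) (\<lambda>w. \<alpha> (pc c d) (glue z w) [] [i])"
      by (rule smooth_on_subst[OF coord_subst_join_right[OF ranges(2,3)] _ formsD(2)[OF \<alpha>(1) pc_atlas[OF c(1) d]]])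
        (rule glue_chart_image(1)[OF c(1) d c(2)])
    fix w j assume w: "w \<in> chart_image d" and j: "j < l"
    \<comment> \<open>The component of \<open>del P \<alpha>\<close> at these indices is a single
      derivative, namely the one that has to vanish along \<open>L\<close>.\<close>
    have "meaningful P (pc c d) (glue z w) [k + j] [i]"
      using pc_atlas[OF c(1) d] glue_chart_image(1)[OF c(1) d c(2) w] iP j ranges(2) by (auto simp: meaningful_def)
    then have "del P \<alpha> (pc c d) (glue z w) [k + j] [i] = dz (k + j) (\<lambda>u. \<alpha> (pc c d) u [] [i]) (glue z w)"
      by (simp add: del_def omit_def)
    then show "dz j (\<lambda>w. \<alpha> (pc c d) (glue z w) [] [i]) w = 0"
      using \<alpha>(2) dz_glue(3)[OF j, of "\<lambda>u. \<alpha> (pc c d) u [] [i]" z w] by simp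
  next
    fix d d' y assume d: "d \<in> atlas L" "d' \<in> atlas L" and y: "y \<in> fst d" "y \<in> fst d'"
    let ?C = "pc c d" and ?D = "pc c d'" and ?z = "glue z (snd d y)"
    have zc: "z \<in> overlap c c"
      using c(2) by (simp add: overlap_self)
    have yd: "snd d y \<in> overlap d d'"
      using y by (auto simp: overlap_def)
    note ov = glue_overlap[OF c(1) d(1) c(1) d(2) zc yd]
    have change': "chart_change ?C ?D ?z = glue z (snd d' y)"
      unfolding ov(2) using chart_change_self[OF c(2)] chart_change_apply[OF atlas_is_chart[OF L d(1)] y(1)] by simp
    have prz: "prM ?z = z"
      using glue_chart_image(2)[OF c(1) d(1) c(2)] yd overlap_subset by blast
    \<comment> \<open>This row of the Jacobian is that of the identity, since the chart of
      \<open>M\<close> does not change and \<open>i\<close> lies in the block of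
      \<open>M\<close>.\<close>
    have dzi: "dz i (\<lambda>w. chart_change ?C ?D w j) ?z = (if j = i then 1 else 0)" if j: "j < mdim P" for j
    proof (cases "j \<in> {m..<m + n}")
      case True
      have "i - m < n" using i by auto
      then have "dz (i - m) (\<lambda>w. chart_change c c w (j - m)) z = dz (i - m) (\<lambda>w. w (j - m)) z"
        by (rule dz_cong[OF chart_image_open[OF M c(1)] c(2)]) (simp only: chart_change_self)
      also have "\<dots> = (if j = i then 1 else 0)"
        using i True by (auto simp: dz_coordinate)
      finally show ?thesis
        unfolding dz_change(1)[OF c(1) d(1) c(1) d(2) ov(1) iP True] prz if_P[OF i] .
    next
      case False
      then have jk: "j \<in> {k..<k + l}" "j \<noteq> i"
        using ranges(4)[OF j] i by blast+
      have "i \<notin> {k..<k + l}"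
        using i ranges(3) by blast
      then show ?thesis
        unfolding dz_change(2)[OF c(1) d(1) c(1) d(2) ov(1) iP jk(1)] using jk(2) by (simp only: if_False)
    qed
    have prod: "(\<Prod>b<length [i]. cnj (dz ([i] ! b) (\<lambda>w. chart_change ?C ?D w (ls ! b)) ?z)) =
        (\<Prod>b<Suc 0. if ls ! b = [i] ! b then 1 else 0)" if "ls \<in> indices (mdim P) (Suc 0)" for ls
    proof -
      have "ls ! 0 < mdim P"
        using that by (auto simp: indices_def subset_iff)
      then show ?thesis
        by (simp add: dzi)
    qed
    \<comment> \<open>Bidegree (0,1) has no holomorphic indices, so the outer sum has the empty list
      as its only term.\<close>
    have ind0: "indices (mdim P) 0 = {[]}"
      by (auto simp: indices_def)
    have indi: "[i] \<in> indices (mdim P) (Suc 0)"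
      using iP by (simp add: indices_def)
    have "\<alpha> ?C ?z [] [i] = (\<Sum>ls\<in>indices (mdim P) (length [i]).
        (\<Prod>b<length [i]. cnj (dz ([i] ! b) (\<lambda>w. chart_change ?C ?D w (ls ! b)) ?z)) * \<alpha> ?D (glue z (snd d' y)) [] ls)"
      using compatibleD[OF formsD(4)[OF \<alpha>(1)] pc_atlas[OF c(1) d(1)] pc_atlas[OF c(1) d(2)] ov(1), of "[]" "[i]"] iP
      unfolding change' by (simp add: ind0)
    also have "\<dots> = (\<Sum>ls\<in>indices (mdim P) (Suc 0).
        (\<Prod>b<Suc 0. if ls ! b = [i] ! b then 1 else 0) * \<alpha> ?D (glue z (snd d' y)) [] ls)"
      by (rule sum.cong) (simp, simp only: prod)
    also have "\<dots> = \<alpha> ?D (glue z (snd d' y)) [] [i]"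
      by (rule sum_indices_delta[OF indi])
    finally show "\<alpha> ?C ?z [] [i] = \<alpha> ?D (glue z (snd d' y)) [] [i]" .
  qed (fact d d')+
qed

text \<open>Pulling back the restriction evaluates \<alpha> at the base point \<open>w0\<close> of
  \<open>L\<close> instead of the actual \<open>L\<close>-coordinates. Constancy along
  \<open>L\<close> removes the difference.\<close>

lemma pull_slice_coefficient:
  assumes cL: "compact_connected_complex_manifold L"
    and \<alpha>: "\<alpha> \<in> forms P 0 1" "del P \<alpha> = 0" and i: "i \<in> {m..<m + n}"
    and mean: "meaningful P C z [] [i]"
  shows "pull (slice \<alpha>) C z [] [i] = \<alpha> C z [] [i]"
proof -
  have C: "C \<in> atlas P" "z \<in> chart_image C"
    using mean by (auto simp: meaningful_def)
  obtain c' where c: "rep C \<in> atlas M" "c' \<in> atlas L" "C = pc (rep C) c'"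
    by (rule rep[OF C(1)])
  have z: "z \<in> cspace (mdim P)" "prM z \<in> chart_image (rep C)" "prL z \<in> chart_image c'"
    using chart_image_pc[OF c(1,2)] c(3) C(2) by simp_all
  have "pull (slice \<alpha>) C z [] [i] = slice \<alpha> (rep C) (prM z) [] [i - m]"
    using mean i by (simp add: pull_def pull_form_def)
  also have "\<dots> = \<alpha> (pc (rep C) c0) (glue (prM z) w0) [] [i]"
    using c(1) z(2) i by (auto simp: slice_def slice_form_def meaningful_def)
  also have "\<dots> = \<alpha> (pc (rep C) c') (glue (prM z) (prL z)) [] [i]"
    by (rule coefficient_constant[OF cL \<alpha> i c(1) z(2) c0 w0 c(2) z(3)])
  also have "\<dots> = \<alpha> C z [] [i]"
    using glue_pr[OF z(1)] c(3) by simp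
  finally show ?thesis .
qed

section \<open>Effect on cocycles and coboundaries\<close>

lemma pull_linear: "form_linear pull"
  unfolding pull_def by (rule form_linear_pull)

lemma slice_linear: "form_linear slice"
  unfolding slice_def by (rule form_linear_slice)

lemma ext_d_pull: "ext_d P (pull \<omega>) = pull (ext_d M \<omega>)"
  unfolding ext_d_def form_linear_add[OF pull_linear] del_pull delbar_pull ..

lemma ext_d_slice: "ext_d M (slice \<omega>) = slice (ext_d P \<omega>)"
  unfolding ext_d_def form_linear_add[OF slice_linear] del_slice delbar_slice ..

lemma pull_BC_cocycles: "\<alpha> \<in> BC_cocycles M p q \<Longrightarrow> pull \<alpha> \<in> BC_cocycles P p q"
  by (simp add: BC_cocycles_def pull_form_in_forms ext_d_pull form_linear_zero[OF pull_linear])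

lemma slice_BC_cocycles: "\<alpha> \<in> BC_cocycles P p q \<Longrightarrow> slice \<alpha> \<in> BC_cocycles M p q"
  by (simp add: BC_cocycles_def slice_form_in_forms ext_d_slice form_linear_zero[OF slice_linear])

lemma slice_BC_coboundaries: "\<alpha> \<in> BC_coboundaries P p q \<Longrightarrow> slice \<alpha> \<in> BC_coboundaries M p q"
proof -
  assume "\<alpha> \<in> BC_coboundaries P p q"
  then obtain \<beta> where \<beta>: "\<alpha> = cscale \<i> (del P (delbar P \<beta>))" "\<beta> \<in> forms P (p - 1) (q - 1)"
    unfolding BC_coboundaries_def by blast
  have "slice \<alpha> = cscale \<i> (del M (delbar M (slice \<beta>)))"
    unfolding \<beta>(1) by (simp only: form_linear_scale[OF slice_linear] del_slice delbar_slice)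
  then show ?thesis
    unfolding BC_coboundaries_def using slice_form_in_forms[OF \<beta>(2)] by blast
qed

lemma pull_A_cocycles: "\<alpha> \<in> A_cocycles M p q \<Longrightarrow> pull \<alpha> \<in> A_cocycles P p q"
  by (simp add: A_cocycles_def pull_form_in_forms del_pull delbar_pull form_linear_scale[OF pull_linear, symmetric]
      form_linear_zero[OF pull_linear])

lemma slice_A_coboundaries: "\<alpha> \<in> A_coboundaries P p q \<Longrightarrow> slice \<alpha> \<in> A_coboundaries M p q"
proof -
  assume "\<alpha> \<in> A_coboundaries P p q"
  then obtain \<beta> \<gamma> where "\<alpha> = del P \<beta> + delbar P \<gamma>" "\<beta> \<in> forms P (p - 1) q" "\<gamma> \<in> forms P p (q - 1)"
    unfolding A_coboundaries_def by blast
  moreover from \<open>\<alpha> = del P \<beta> + delbar P \<gamma>\<close> have "slice \<alpha> = del M (slice \<beta>) + delbar M (slice \<gamma>)"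
    by (simp only: form_linear_add[OF slice_linear] del_slice delbar_slice)
  ultimately show ?thesis
    unfolding A_coboundaries_def using slice_form_in_forms by blast
qed

end

lemma zero_in_BC_coboundaries: "0 \<in> BC_coboundaries M p q"
proof -
  have "0 = cscale \<i> (del M (delbar M 0))"
    by (simp only: delbar_zero del_zero cscale_zero)
  then show ?thesis
    unfolding BC_coboundaries_def by (intro CollectI exI[of _ 0] conjI zero_in_forms)
qed

lemma zero_in_A_coboundaries: "0 \<in> A_coboundaries M p q"
proof -
  have "0 = del M 0 + delbar M 0"
    by (simp only: delbar_zero del_zero add_0)
  then show ?thesis
    unfolding A_coboundaries_def by (intro CollectI exI[of _ 0] conjI zero_in_forms)
qed

text \<open>List lengths are never negative, so the only form of bidegree (-1,0) is zero.\<close>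

lemma BC_coboundaries_0_1: "BC_coboundaries M 0 1 = {0}"
proof -
  have "forms M (0 - 1) (1 - 1) = {0}"
    by (rule forms_negative) simp
  then show ?thesis
    unfolding BC_coboundaries_def by (simp add: delbar_zero del_zero)
qed

text \<open>Both readings use the same product charts. The second one swaps the roles of the
  factors, and the block of \<open>Y\<close> still begins at \<open>mdim X\<close>.\<close>

lemma product_factor_prod_chart:
  assumes X: "complex_manifold X" and Y: "complex_manifold Y"
  shows "product_factor (prod_manifold X Y) X Y (prod_chart (mdim X)) 0 (mdim X)"
    and "product_factor (prod_manifold X Y) Y X (\<lambda>d c. prod_chart (mdim X) c d) (mdim X) 0"
proof -
  note cX = atlas_is_chart[OF X] and cY = atlas_is_chart[OF Y]
  have ne: "fst C \<noteq> {}" if "chart_image C \<noteq> {}" for C :: "'c chart"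
    using that by (auto simp: chart_image_def)
  show "product_factor (prod_manifold X Y) X Y (prod_chart (mdim X)) 0 (mdim X)"
  proof
    fix c c' d d' assume c: "c \<in> atlas X" "c' \<in> atlas Y" "d \<in> atlas X" "d' \<in> atlas Y"
    note ch = cX[OF c(1)] cY[OF c(2)] cX[OF c(3)] cY[OF c(4)]
    let ?C = "prod_chart (mdim X) c c'" and ?D = "prod_chart (mdim X) d d'"
    show "overlap ?C ?D = {z \<in> cspace (mdim (prod_manifold X Y)).
        coords 0 (mdim X) z \<in> overlap c d \<and> coords (mdim X) (mdim Y) z \<in> overlap c' d'}"
      using overlap_prod_chart[OF ch] by (simp add: prod_manifold_def)
    show "chart_change ?C ?D z \<in> cspace (mdim (prod_manifold X Y)) \<and>
        coords 0 (mdim X) (chart_change ?C ?D z) = chart_change c d (coords 0 (mdim X) z) \<and>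
        coords (mdim X) (mdim Y) (chart_change ?C ?D z) = chart_change c' d' (coords (mdim X) (mdim Y) z)"
      if "z \<in> overlap ?C ?D" for z
      using chart_change_prod_chart[OF ch that] by (simp add: prod_manifold_def)
    show "fst c = fst d \<and> (\<forall>x\<in>fst c. snd c x = snd d x)" if "?C = ?D" "chart_image ?C \<noteq> {}"
      using prod_chart_eqD(1,2)[OF ch that(1) ne[OF that(2)]] by blast
  qed (use X Y in \<open>auto simp: prod_manifold_def\<close>)
  show "product_factor (prod_manifold X Y) Y X (\<lambda>d c. prod_chart (mdim X) c d) (mdim X) 0"
  proof
    fix c' c d' d assume c: "c' \<in> atlas Y" "c \<in> atlas X" "d' \<in> atlas Y" "d \<in> atlas X"
    note ch = cX[OF c(2)] cY[OF c(1)] cX[OF c(4)] cY[OF c(3)]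
    let ?C = "prod_chart (mdim X) c c'" and ?D = "prod_chart (mdim X) d d'"
    show "overlap ?C ?D = {z \<in> cspace (mdim (prod_manifold X Y)).
        coords (mdim X) (mdim Y) z \<in> overlap c' d' \<and> coords 0 (mdim X) z \<in> overlap c d}"
      using overlap_prod_chart[OF ch] by (auto simp: prod_manifold_def)
    show "chart_change ?C ?D z \<in> cspace (mdim (prod_manifold X Y)) \<and>
        coords (mdim X) (mdim Y) (chart_change ?C ?D z) = chart_change c' d' (coords (mdim X) (mdim Y) z) \<and>
        coords 0 (mdim X) (chart_change ?C ?D z) = chart_change c d (coords 0 (mdim X) z)"
      if "z \<in> overlap ?C ?D" for z
      using chart_change_prod_chart[OF ch that] by (simp add: prod_manifold_def)
    show "fst c' = fst d' \<and> (\<forall>x\<in>fst c'. snd c' x = snd d' x)" if "?C = ?D" "chart_image ?C \<noteq> {}"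
      using prod_chart_eqD(3,4)[OF ch that(1) ne[OF that(2)]] by blast
  qed (use X Y in \<open>auto simp: prod_manifold_def\<close>)
qed

lemma obtain_chart_point:
  assumes "compact_connected_complex_manifold M"
  obtains c z where "c \<in> atlas M" "z \<in> chart_image c"
proof -
  have "(\<Union>c\<in>atlas M. fst c) \<noteq> {}"
    using assms by (simp only: compact_connected_complex_manifold_def complex_manifold_def) simp
  then obtain c x where "c \<in> atlas M" "x \<in> fst c"
    by blast
  then show ?thesis
    using that[of c "snd c x"] by (simp add: chart_image_def)
qed

theorem theorem2:
  fixes X :: "'a manifold" and Y :: "'b manifold"
  assumes "compact_connected_complex_manifold X"
    and "compact_connected_complex_manifold Y"
  shows "h_BC 0 1 (prod_manifold X Y) = h_BC 0 1 X + h_BC 0 1 Y \<and>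
         h_A 0 1 (prod_manifold X Y) \<ge> h_A 0 1 X + h_A 0 1 Y"
proof -
  let ?P = "prod_manifold X Y"
  have cm: "complex_manifold X" "complex_manifold Y"
    using assms by (auto simp: compact_connected_complex_manifold_def)
  obtain cX zX where X: "cX \<in> atlas X" "zX \<in> chart_image cX"
    by (rule obtain_chart_point[OF assms(1)])
  obtain cY zY where Y: "cY \<in> atlas Y" "zY \<in> chart_image cY"
    by (rule obtain_chart_point[OF assms(2)])
  \<comment> \<open>The slice for \<open>X\<close> passes through a point of \<open>Y\<close>, and
    vice versa; the base points are arbitrary.\<close>
  interpret X: product_slice ?P X Y "prod_chart (mdim X)" 0 "mdim X" cY zY
    by (intro product_slice.intro product_factor_prod_chart cm product_slice_axioms.intro Y)
  interpret Y: product_slice ?P Y X "\<lambda>d c. prod_chart (mdim X) c d" "mdim X" 0 cX zX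
    by (intro product_slice.intro product_factor_prod_chart cm product_slice_axioms.intro X)
  \<comment> \<open>The bidegree differs from (0,0), so the cross restrictions vanish on forms and
    not merely on classes.\<close>
  have cross1: "Y.slice (X.pull \<alpha>) = 0" if "\<alpha> \<in> forms X 0 1" for \<alpha>
    unfolding X.pull_def Y.slice_def by (rule slice_pull_cross[OF _ that]) auto
  have cross2: "X.slice (Y.pull \<alpha>) = 0" if "\<alpha> \<in> forms Y 0 1" for \<alpha>
    unfolding Y.pull_def X.slice_def by (rule slice_pull_cross[OF _ that]) auto
  have split: "\<alpha> = X.pull (X.slice \<alpha>) + Y.pull (Y.slice \<alpha>)" if \<alpha>: "\<alpha> \<in> BC_cocycles ?P 0 1" for \<alpha>
  proof -
    have f: "\<alpha> \<in> forms ?P 0 1" and d: "del ?P \<alpha> = 0"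
      using \<alpha> del_eq_zero_if_ext_d_eq_zero[of \<alpha>] by (auto simp: BC_cocycles_def)
    note fX = X.pull_form_in_forms[OF X.slice_form_in_forms[OF f]]
      and fY = Y.pull_form_in_forms[OF Y.slice_form_in_forms[OF f]]
    have "\<alpha> C z ps qs = X.pull (X.slice \<alpha>) C z ps qs + Y.pull (Y.slice \<alpha>) C z ps qs" for C z ps qs
    proof (cases "meaningful ?P C z ps qs \<and> int (length ps) = 0 \<and> int (length qs) = 1")
      case True
      then obtain i where pq: "ps = []" "qs = [i]"
        by (auto simp: length_Suc_conv)
      have mean: "meaningful ?P C z [] [i]" and iP: "i < mdim ?P"
        using True pq by (auto simp: meaningful_def)
      \<comment> \<open>The blocks are disjoint and cover all indices, so exactly one of the two
        pullbacks contributes to this coefficient.\<close>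
      consider "i \<in> {0..<0 + mdim X}" "i \<notin> {mdim X..<mdim X + mdim Y}"
        | "i \<notin> {0..<0 + mdim X}" "i \<in> {mdim X..<mdim X + mdim Y}"
        using X.ranges(3) X.ranges(4)[OF iP] by auto
      then show ?thesis
      proof cases
        case 1
        have "Y.pull (Y.slice \<alpha>) C z [] [i] = 0"
          using 1(2) by (auto simp: Y.pull_def pull_form_def)
        then show ?thesis
          using X.pull_slice_coefficient[OF assms(2) f d 1(1) mean] by (simp add: pq)
      next
        case 2
        have "X.pull (X.slice \<alpha>) C z [] [i] = 0"
          using 2(1) by (auto simp: X.pull_def pull_form_def)
        then show ?thesis
          using Y.pull_slice_coefficient[OF assms(1) f d 2(2) mean] by (simp add: pq)
      qed
    next
      case False
      then show ?thesis
        using formsD(1)[OF f False] formsD(1)[OF fX False] formsD(1)[OF fY False] by simp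
    qed
    then show ?thesis
      by (intro ext) simp
  qed
  \<comment> \<open>With zero coboundaries the dimension is that of the cocycle space, which the
    decomposition bounds from above.\<close>
  have "h_BC 0 1 ?P \<le> h_BC 0 1 X + h_BC 0 1 Y"
    unfolding h_BC_def BC_coboundaries_0_1
    by (rule quotient_dim_zero_le_add[where ?\<sigma>1.0 = X.slice and ?\<sigma>2.0 = Y.slice, OF X.pull_linear Y.pull_linear])
      (fact X.slice_BC_cocycles Y.slice_BC_cocycles split)+
  moreover have "h_BC 0 1 X + h_BC 0 1 Y \<le> h_BC 0 1 ?P"
    unfolding h_BC_def
  proof (rule quotient_dim_add_le[where ?\<iota>1.0 = X.pull and ?\<iota>2.0 = Y.pull, OF X.slice_linear Y.slice_linear])
    fix \<alpha> assume "\<alpha> \<in> BC_cocycles X 0 1"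
    then have \<alpha>: "\<alpha> \<in> forms X 0 1"
      by (simp add: BC_cocycles_def)
    show "X.slice (X.pull \<alpha>) = \<alpha>"
      by (rule X.slice_pull[OF \<alpha>])
    show "Y.slice (X.pull \<alpha>) = 0"
      by (rule cross1[OF \<alpha>])
  next
    fix \<alpha> assume "\<alpha> \<in> BC_cocycles Y 0 1"
    then have \<alpha>: "\<alpha> \<in> forms Y 0 1"
      by (simp add: BC_cocycles_def)
    show "Y.slice (Y.pull \<alpha>) = \<alpha>"
      by (rule Y.slice_pull[OF \<alpha>])
    show "X.slice (Y.pull \<alpha>) = 0"
      by (rule cross2[OF \<alpha>])
  qed (fact X.pull_BC_cocycles Y.pull_BC_cocycles X.slice_BC_coboundaries Y.slice_BC_coboundaries
      zero_in_BC_coboundaries)+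
  moreover have "h_A 0 1 X + h_A 0 1 Y \<le> h_A 0 1 ?P"
    unfolding h_A_def
  proof (rule quotient_dim_add_le[where ?\<iota>1.0 = X.pull and ?\<iota>2.0 = Y.pull, OF X.slice_linear Y.slice_linear])
    fix \<alpha> assume "\<alpha> \<in> A_cocycles X 0 1"
    then have \<alpha>: "\<alpha> \<in> forms X 0 1"
      by (simp add: A_cocycles_def)
    show "X.slice (X.pull \<alpha>) = \<alpha>"
      by (rule X.slice_pull[OF \<alpha>])
    show "Y.slice (X.pull \<alpha>) = 0"
      by (rule cross1[OF \<alpha>])
  next
    fix \<alpha> assume "\<alpha> \<in> A_cocycles Y 0 1"
    then have \<alpha>: "\<alpha> \<in> forms Y 0 1"
      by (simp add: A_cocycles_def)
    show "Y.slice (Y.pull \<alpha>) = \<alpha>"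
      by (rule Y.slice_pull[OF \<alpha>])
    show "X.slice (Y.pull \<alpha>) = 0"
      by (rule cross2[OF \<alpha>])
  qed (fact X.pull_A_cocycles Y.pull_A_cocycles X.slice_A_coboundaries Y.slice_A_coboundaries
      zero_in_A_coboundaries)+
  ultimately show ?thesis
    by simp
qed

end
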